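(* Let $f \in \mathbb{C}[x_1,\ldots,x_n]$ and $g \in \mathbb{C}[y_1,\ldots,y_m]$ be homogeneous and reduced polynomials of positive degrees $r$ and $s$ respectively, in separate sets of variables. Then there is a fibration \[ F_{fg}^* \to F_f^* \times F_g^* \] defined by \[ [x_1:\ldots:x_n:y_1:\ldots:y_m] \mapsto ([x_1:\ldots:x_n],[y_1:\ldots:y_m]), \] with fiber $\mathbb{C}^*$ and trivial geometric monodromy.
   Context: For a homogeneous polynomial $h \in \mathbb{C}[z_1,\ldots,z_t]$ of positive degree, $F_h = h^{-1}(1) \subset \mathbb{C}^t$ denotes its Milnor fiber. The product $fg$ is regarded as a homogeneous polynomial in $\mathbb{C}[x_1,\ldots,x_n,y_1,\ldots,y_m]$, so $F_{fg} \subset \mathbb{C}^n\times\mathbb{C}^m$. For $M \subseteq \mathbb{C}^t\setminus\{0\}$, $M^*$ denotes the image of $M$ under the Hopf fibration $\rho:\mathbb{C}^t\setminus\{0\}\to\mathbb{P}^{t-1}$; thus $F_h^*$ is the complement in $\mathbb{P}^{t-1}$ of the projective hypersurface $h=0$. "Reduced" means without repeated irreducible factors. Given a smooth fibration $F \to M \to N$ and a loop in the base $N$, lifting the loop through local trivializations produces a diffeomorphism of the fiber $F$. The fibration has trivial geometric monodromy if, for every loop in $N$, this diffeomorphism is homotopic to the identity. *)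

theory Defs
  imports "HOL-Analysis.Analysis" "HOL-Library.Poly_Mapping"
    "HOL-Computational_Algebra.Factorial_Ring"
begin

section \<open>Polynomials\<close>

text \<open>Polynomials over \<open>\<complex>\<close> with variables indexed by \<open>'v\<close>: a monomial is a finitely supported
  exponent vector, a polynomial a finitely supported family of coefficients. The ring structure
  (convolution product) is the one of \<^theory>\<open>HOL-Library.Poly_Mapping\<close>.\<close>

type_synonym 'v cpoly = "('v \<Rightarrow>\<^sub>0 nat) \<Rightarrow>\<^sub>0 complex"

definition poly_eval :: "'v::finite cpoly \<Rightarrow> complex ^ 'v \<Rightarrow> complex" where
  "poly_eval p z =
     (\<Sum>m\<in>Poly_Mapping.keys p. Poly_Mapping.lookup p m * (\<Prod>i\<in>UNIV. (z $ i) ^ Poly_Mapping.lookup m i))"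

definition homogeneous :: "nat \<Rightarrow> 'v::finite cpoly \<Rightarrow> bool" where
  "homogeneous d p \<longleftrightarrow>
     p \<noteq> 0 \<and> (\<forall>m\<in>Poly_Mapping.keys p. (\<Sum>i\<in>UNIV. Poly_Mapping.lookup m i) = d)"

definition reduced_poly :: "'v cpoly \<Rightarrow> bool" where
  "reduced_poly p \<longleftrightarrow> p \<noteq> 0 \<and> (\<forall>q. irreducible q \<longrightarrow> \<not> q ^ 2 dvd p)"

text \<open>Renaming of variables; with \<^const>\<open>Inl\<close> and \<^const>\<open>Inr\<close> it regards
  \<open>\<complex>[x]\<close> and \<open>\<complex>[y]\<close> as subrings of \<open>\<complex>[x, y]\<close>.\<close>

definition rename_vars :: "('v::finite \<Rightarrow> 'w) \<Rightarrow> 'v cpoly \<Rightarrow> 'w cpoly" where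
  "rename_vars \<sigma> p =
     (\<Sum>m\<in>Poly_Mapping.keys p. Poly_Mapping.single
        (\<Sum>i\<in>UNIV. Poly_Mapping.single (\<sigma> i) (Poly_Mapping.lookup m i)) (Poly_Mapping.lookup p m))"

definition sep_prod :: "'n::finite cpoly \<Rightarrow> 'm::finite cpoly \<Rightarrow> ('n + 'm) cpoly" where
  "sep_prod f g = rename_vars Inl f * rename_vars Inr g"

definition milnor_fiber :: "'v::finite cpoly \<Rightarrow> (complex ^ 'v) set" where
  "milnor_fiber h = {z. poly_eval h z = 1}"

definition vjoin :: "complex ^ 'n \<Rightarrow> complex ^ 'm \<Rightarrow> complex ^ ('n::finite + 'm::finite)" where
  "vjoin x y = (\<chi> k. case k of Inl i \<Rightarrow> x $ i | Inr j \<Rightarrow> y $ j)"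


section \<open>Complex projective space\<close>

definition proj_rel :: "complex ^ 'n \<Rightarrow> complex ^ 'n \<Rightarrow> bool" where
  "proj_rel z w \<longleftrightarrow> z \<noteq> 0 \<and> w \<noteq> 0 \<and> (\<exists>c. c \<noteq> 0 \<and> w = c *s z)"

lemma part_equivp_proj_rel: "part_equivp (proj_rel :: complex ^ 'n::finite \<Rightarrow> _)"
proof (rule part_equivpI)
  show "\<exists>z :: complex ^ 'n. proj_rel z z"
    by (rule exI[of _ 1]) (auto simp: proj_rel_def intro!: exI[of _ 1])
  show "symp (proj_rel :: complex ^ 'n \<Rightarrow> _)"
  proof (rule sympI)
    fix z w :: "complex ^ 'n"
    assume "proj_rel z w"
    then obtain c where "z \<noteq> 0" "w \<noteq> 0" "c \<noteq> 0" "w = c *s z"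
      by (auto simp: proj_rel_def)
    then show "proj_rel w z"
      by (auto simp: proj_rel_def vector_smult_assoc intro!: exI[of _ "inverse c"])
  qed
  show "transp (proj_rel :: complex ^ 'n \<Rightarrow> _)"
  proof (rule transpI)
    fix x y z :: "complex ^ 'n"
    assume "proj_rel x y" "proj_rel y z"
    then obtain c d where "x \<noteq> 0" "z \<noteq> 0" "c \<noteq> 0" "y = c *s x" "d \<noteq> 0" "z = d *s y"
      by (auto simp: proj_rel_def)
    then show "proj_rel x z"
      by (auto simp: proj_rel_def vector_smult_assoc intro!: exI[of _ "d * c"])
  qed
qed

text \<open>The projective space of lines in \<open>complex ^ 'n\<close>, of complex dimension \<open>CARD('n) - 1\<close>.
  The quotient is partial: \<open>hopf\<close> is the Hopf fibration, and \<open>hopf 0\<close> is meaningless.\<close>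

quotient_type 'n cproj = "complex ^ 'n::finite" / partial: proj_rel
  morphisms rep_cproj hopf
  by (rule part_equivp_proj_rel)

text \<open>The quotient topology.\<close>

instantiation cproj :: (finite) topological_space
begin

definition open_cproj :: "'a cproj set \<Rightarrow> bool" where
  "open_cproj U \<longleftrightarrow> open {z :: complex ^ 'a. z \<noteq> 0 \<and> hopf z \<in> U}"

instance
proof
  have "{z :: complex ^ 'a. z \<noteq> 0 \<and> hopf z \<in> UNIV} = - {0}" by auto
  then show "open (UNIV :: 'a cproj set)"
    unfolding open_cproj_def by (simp only: open_Compl closed_singleton)
next
  fix S T :: "'a cproj set"
  assume "open S" "open T"
  moreover have "{z :: complex ^ 'a. z \<noteq> 0 \<and> hopf z \<in> S \<inter> T} =
      {z. z \<noteq> 0 \<and> hopf z \<in> S} \<inter> {z. z \<noteq> 0 \<and> hopf z \<in> T}" by auto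
  ultimately show "open (S \<inter> T)"
    unfolding open_cproj_def by (simp only: open_Int)
next
  fix K :: "'a cproj set set"
  assume "\<forall>S\<in>K. open S"
  moreover have "{z :: complex ^ 'a. z \<noteq> 0 \<and> hopf z \<in> \<Union>K} =
      (\<Union>S\<in>K. {z. z \<noteq> 0 \<and> hopf z \<in> S})" by auto
  ultimately show "open (\<Union>K)"
    unfolding open_cproj_def by auto
qed

end


section \<open>Smooth maps\<close>

primrec Ck_on :: "nat \<Rightarrow> ('a::real_normed_vector \<Rightarrow> 'b::real_normed_vector) \<Rightarrow> 'a set \<Rightarrow> bool" where
  "Ck_on 0 f W \<longleftrightarrow> continuous_on W f"
| "Ck_on (Suc k) f W \<longleftrightarrow>
     (\<forall>x\<in>W. f differentiable (at x)) \<and> (\<forall>v. Ck_on k (\<lambda>x. frechet_derivative f (at x) v) W)"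

text \<open>Smoothness on an arbitrary subset \<open>S\<close> of a Euclidean space: locally there is a smooth
  extension to an ambient open set. If \<open>S\<close> is open in an affine subspace, this is smoothness on
  \<open>S\<close> in the usual sense.\<close>

definition smooth_on :: "'a::euclidean_space set \<Rightarrow> ('a \<Rightarrow> 'b::euclidean_space) \<Rightarrow> bool" where
  "smooth_on S f \<longleftrightarrow>
     (\<forall>x\<in>S. \<exists>W g. open W \<and> x \<in> W \<and> (\<forall>k. Ck_on k g W) \<and> (\<forall>y\<in>S \<inter> W. g y = f y))"

text \<open>A chart is an open set with a homeomorphism from it onto an open subset of an affine subspace
  of a Euclidean space; a manifold is presented as an open subset \<open>pts\<close> of a space with a smooth
  atlas \<open>charts\<close>. These requirements are not part of the type; they hold for the manifolds below.\<close>

datatype ('a, 'e) mfd = Mfd (pts: "'a set") (charts: "('a set \<times> ('a \<Rightarrow> 'e)) set")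

definition smooth_map ::
    "('a::topological_space, 'e::euclidean_space) mfd \<Rightarrow>
     ('b::topological_space, 'f::euclidean_space) mfd \<Rightarrow> ('a \<Rightarrow> 'b) \<Rightarrow> bool" where
  "smooth_map M N h \<longleftrightarrow>
     h \<in> pts M \<rightarrow> pts N \<and> continuous_on (pts M) h \<and>
     (\<forall>(U, \<phi>)\<in>charts M. \<forall>(V, \<psi>)\<in>charts N.
        smooth_on (\<phi> ` {p \<in> pts M \<inter> U. h p \<in> V}) (\<psi> \<circ> h \<circ> inv_into U \<phi>))"

definition diffeomorphism ::
    "('a::topological_space, 'e::euclidean_space) mfd \<Rightarrow>
     ('b::topological_space, 'f::euclidean_space) mfd \<Rightarrow> ('a \<Rightarrow> 'b) \<Rightarrow> bool" where
  "diffeomorphism M N h \<longleftrightarrow>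
     bij_betw h (pts M) (pts N) \<and> smooth_map M N h \<and> smooth_map N M (inv_into (pts M) h)"

definition prod_mfd :: "('a, 'e) mfd \<Rightarrow> ('b, 'f) mfd \<Rightarrow> ('a \<times> 'b, 'e \<times> 'f) mfd" where
  "prod_mfd M N = Mfd (pts M \<times> pts N)
     {(U \<times> V, map_prod \<phi> \<psi>) | U \<phi> V \<psi>. (U, \<phi>) \<in> charts M \<and> (V, \<psi>) \<in> charts N}"

text \<open>Restriction to an open subset.\<close>

definition restrict_mfd :: "('a, 'e) mfd \<Rightarrow> 'a set \<Rightarrow> ('a, 'e) mfd" where
  "restrict_mfd M S = Mfd (pts M \<inter> S) (charts M)"

definition euclidean_mfd :: "('a::euclidean_space, 'a) mfd" where
  "euclidean_mfd = Mfd UNIV {(UNIV, id)}"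

text \<open>The \<open>i\<close>-th affine chart \<open>[z] \<mapsto> (z\<^sub>j / z\<^sub>i)\<^sub>j\<close>. Its \<open>i\<close>-th entry, constantly \<open>1\<close>, is not
  dropped, so that the chart takes values in the affine hyperplane \<open>w\<^sub>i = 1\<close>.\<close>

lift_definition affine_coord :: "'n::finite \<Rightarrow> 'n cproj \<Rightarrow> complex ^ 'n"
  is "\<lambda>i z. inverse (z $ i) *s z"
  by (auto simp: proj_rel_def vector_smult_assoc vec_eq_iff field_simps)

definition proj_mfd :: "('n::finite cproj, complex ^ 'n) mfd" where
  "proj_mfd = Mfd UNIV {(hopf ` {z. z $ i \<noteq> 0}, affine_coord i) | i. True}"


section \<open>Smooth fibrations and geometric monodromy\<close>

definition local_trivialization ::
    "('a::topological_space, 'e::euclidean_space) mfd \<Rightarrow>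
     ('b::topological_space, 'f::euclidean_space) mfd \<Rightarrow>
     ('c::topological_space, 'g::euclidean_space) mfd \<Rightarrow> ('a \<Rightarrow> 'b) \<Rightarrow>
     'b set \<Rightarrow> ('a \<Rightarrow> 'b \<times> 'c) \<Rightarrow> bool" where
  "local_trivialization M N F \<pi> U \<phi> \<longleftrightarrow>
     openin (top_of_set (pts N)) U \<and>
     diffeomorphism (restrict_mfd M (\<pi> -` U)) (prod_mfd (restrict_mfd N U) F) \<phi> \<and>
     (\<forall>p\<in>pts M \<inter> \<pi> -` U. fst (\<phi> p) = \<pi> p)"

definition smooth_fibration ::
    "('a::topological_space, 'e::euclidean_space) mfd \<Rightarrow>
     ('b::topological_space, 'f::euclidean_space) mfd \<Rightarrow>
     ('c::topological_space, 'g::euclidean_space) mfd \<Rightarrow> ('a \<Rightarrow> 'b) \<Rightarrow> bool" where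
  "smooth_fibration M N F \<pi> \<longleftrightarrow>
     smooth_map M N \<pi> \<and> (\<forall>b\<in>pts N. \<exists>U \<phi>. b \<in> U \<and> local_trivialization M N F \<pi> U \<phi>)"

text \<open>\<open>transport M N F \<pi> \<gamma> s t h\<close>: the map \<open>h\<close> from the fiber over \<open>\<gamma> s\<close> to the fiber over \<open>\<gamma> t\<close>
  arises by lifting \<open>\<gamma>\<close> on \<open>[s, t]\<close> through local trivializations. While \<open>\<gamma>\<close> stays in the domain of
  a single one, a point is moved keeping its \<open>F\<close>-coordinate; in general \<open>[s, t]\<close> is subdivided.
  The result depends on the choices made (but not up to homotopy), hence a relation.\<close>

inductive transport ::
    "('a::topological_space, 'e::euclidean_space) mfd \<Rightarrow>
     ('b::topological_space, 'f::euclidean_space) mfd \<Rightarrow>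
     ('c::topological_space, 'g::euclidean_space) mfd \<Rightarrow> ('a \<Rightarrow> 'b) \<Rightarrow>
     (real \<Rightarrow> 'b) \<Rightarrow> real \<Rightarrow> real \<Rightarrow> ('a \<Rightarrow> 'a) \<Rightarrow> bool"
  for M N F \<pi> \<gamma> where
  step: "s \<le> t \<Longrightarrow> local_trivialization M N F \<pi> U \<phi> \<Longrightarrow> \<gamma> ` {s..t} \<subseteq> U \<Longrightarrow>
    transport M N F \<pi> \<gamma> s t (\<lambda>p. inv_into (pts M \<inter> \<pi> -` U) \<phi> (\<gamma> t, snd (\<phi> p)))"
| comp: "transport M N F \<pi> \<gamma> s t h \<Longrightarrow> transport M N F \<pi> \<gamma> t u k \<Longrightarrow>
    transport M N F \<pi> \<gamma> s u (k \<circ> h)"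

text \<open>The diffeomorphism of the fiber is taken on the actual fiber over the base point.\<close>

definition trivial_geometric_monodromy ::
    "('a::topological_space, 'e::euclidean_space) mfd \<Rightarrow>
     ('b::topological_space, 'f::euclidean_space) mfd \<Rightarrow>
     ('c::topological_space, 'g::euclidean_space) mfd \<Rightarrow> ('a \<Rightarrow> 'b) \<Rightarrow> bool" where
  "trivial_geometric_monodromy M N F \<pi> \<longleftrightarrow>
     (\<forall>\<gamma> h. path \<gamma> \<and> path_image \<gamma> \<subseteq> pts N \<and> pathfinish \<gamma> = pathstart \<gamma> \<and>
        transport M N F \<pi> \<gamma> 0 1 h \<longrightarrow>
        homotopic_with_canon (\<lambda>_. True)
          (pts M \<inter> \<pi> -` {pathstart \<gamma>}) (pts M \<inter> \<pi> -` {pathstart \<gamma>}) h id)"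

text \<open>Transport exists along every path, so the quantification over \<open>h\<close> above is not vacuous.\<close>

lemma transport_exists:
  assumes fib: "smooth_fibration M N F \<pi>" and path: "path \<gamma>" "path_image \<gamma> \<subseteq> pts N"
  shows "\<exists>h. transport M N F \<pi> \<gamma> 0 1 h"
proof -
  have "0 \<le> (0::real) \<and> (1::real) \<le> 1 \<longrightarrow> (\<exists>h. transport M N F \<pi> \<gamma> 0 1 h)"
  proof (rule Bolzano[of 0 1 "\<lambda>s t. 0 \<le> s \<and> t \<le> 1 \<longrightarrow> (\<exists>h. transport M N F \<pi> \<gamma> s t h)"])
    fix a b c :: real
    assume "0 \<le> a \<and> b \<le> 1 \<longrightarrow> (\<exists>h. transport M N F \<pi> \<gamma> a b h)"
      "0 \<le> b \<and> c \<le> 1 \<longrightarrow> (\<exists>h. transport M N F \<pi> \<gamma> b c h)" "a \<le> b" "b \<le> c"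
    then show "0 \<le> a \<and> c \<le> 1 \<longrightarrow> (\<exists>h. transport M N F \<pi> \<gamma> a c h)"
      by (meson order_trans transport.comp)
  next
    fix x :: real
    assume x: "0 \<le> x" "x \<le> 1"
    then have "\<gamma> x \<in> pts N"
      using path(2) by (auto simp: path_image_def)
    then obtain U \<phi> where U: "\<gamma> x \<in> U" "local_trivialization M N F \<pi> U \<phi>"
      using fib unfolding smooth_fibration_def by blast
    then obtain T where T: "open T" "U = pts N \<inter> T"
      by (auto simp: local_trivialization_def openin_open)
    have "continuous_on {0..1} \<gamma>"
      using path(1) by (simp add: path_def)
    then obtain A where A: "open A" "A \<inter> {0..1} = \<gamma> -` T \<inter> {0..1}"
      using T(1) by (metis continuous_on_open_invariant)
    then have "x \<in> A"
      using x U(1) T(2) by auto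
    then obtain d where d: "d > 0" "ball x d \<subseteq> A"
      using A(1) open_contains_ball by blast
    show "\<exists>d>0. \<forall>a b. a \<le> x \<and> x \<le> b \<and> b - a < d \<longrightarrow>
        0 \<le> a \<and> b \<le> 1 \<longrightarrow> (\<exists>h. transport M N F \<pi> \<gamma> a b h)"
    proof (intro exI[of _ d] conjI d(1) allI impI)
      fix a b
      assume ab: "a \<le> x \<and> x \<le> b \<and> b - a < d" "0 \<le> a \<and> b \<le> 1"
      have "{a..b} \<subseteq> ball x d"
        using ab(1) by (auto simp: dist_real_def)
      then have "\<gamma> ` {a..b} \<subseteq> U"
        using d(2) A(2) ab(2) T(2) path(2) unfolding path_image_def by fastforce
      then show "\<exists>h. transport M N F \<pi> \<gamma> a b h"
        using transport.step[OF _ U(2)] ab(1) by (meson order_trans)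
    qed
  qed simp
  then show ?thesis by simp
qed

end

theory Submission
  imports Defs
begin

text \<open>
  The projection \<open>\<pi> [x : y] = ([x], [y])\<close> is a principal \<open>\<complex>\<^sup>*\<close>-bundle, the group acting by
  \<open>t [x : y] = [x : t y]\<close>. Both blocks of coordinates are nonzero on \<open>F\<^sub>f\<^sub>g\<^sup>*\<close>, because a
  homogeneous polynomial of positive degree vanishes at \<open>0\<close>. Over the set where \<open>x\<^sub>i \<noteq> 0\<close> and
  \<open>y\<^sub>j \<noteq> 0\<close>, the function \<open>y\<^sub>j / x\<^sub>i\<close> is a fiber coordinate and gives a local trivialization
  (\<open>local_trivialization_triv\<close>). In affine charts it and its inverse are given by rational
  functions, whose smoothness follows from closure properties of the \<open>C\<^sup>k\<close> maps.

  For the monodromy consider \<open>E = g\<^sup>r / f\<^sup>s\<close>, which has degree \<open>0\<close> and therefore defines a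
  continuous map \<open>F\<^sub>f\<^sub>g\<^sup>* \<rightarrow> \<complex>\<^sup>*\<close>. Let \<open>h\<close> be transport around a loop, made up from arbitrary local
  trivializations. A transported point traces a path in the total space, so that \<open>E \<circ> h\<close> is
  homotopic to \<open>E\<close> on the fiber (\<open>transport_homotopic\<close>). In a coordinate \<open>t \<in> \<complex>\<^sup>*\<close> of the fiber,
  \<open>E\<close> is \<open>c t\<^sup>r\<^sup>s\<close> with \<open>c \<noteq> 0\<close>. Hence \<open>h\<^sup>r\<^sup>s\<close> has the same degree as \<open>t\<^sup>r\<^sup>s\<close>, the self-map \<open>h\<close>
  of \<open>\<complex>\<^sup>*\<close> has degree one, and it is homotopic to the identity
  (\<open>homotopic_id_if_power_homotopic\<close>).
\<close>

section \<open>Evaluation of polynomials in separate sets of variables\<close>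

lemma poly_eval_add: "poly_eval (p + q) z = poly_eval p z + poly_eval q z"
  unfolding poly_eval_def
  by (rule setsum_keys_plus_distrib) (simp_all add: distrib_right)

lemma poly_eval_0 [simp]: "poly_eval 0 z = 0"
  by (simp add: poly_eval_def)

lemma poly_eval_sum: "poly_eval (\<Sum>a\<in>A. p a) z = (\<Sum>a\<in>A. poly_eval (p a) z)"
  by (induction A rule: infinite_finite_induct) (auto simp: poly_eval_add)

lemma poly_eval_single:
  "poly_eval (Poly_Mapping.single m c) z = c * (\<Prod>i\<in>UNIV. (z $ i) ^ Poly_Mapping.lookup m i)"
  by (cases "c = 0") (auto simp: poly_eval_def)

lemma cpoly_eq_sum_monomials:
  "p = (\<Sum>m\<in>Poly_Mapping.keys p. Poly_Mapping.single m (Poly_Mapping.lookup p m))"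
  by (rule poly_mapping_eqI) (auto simp: lookup_sum lookup_single when_def in_keys_iff)

lemma poly_eval_mult: "poly_eval (p * q) z = poly_eval p z * poly_eval q z"
proof -
  have "p * q = (\<Sum>m\<in>Poly_Mapping.keys p. \<Sum>l\<in>Poly_Mapping.keys q.
      Poly_Mapping.single (m + l) (Poly_Mapping.lookup p m * Poly_Mapping.lookup q l))"
    by (subst cpoly_eq_sum_monomials[of p], subst cpoly_eq_sum_monomials[of q])
      (simp add: sum_product mult_single)
  then show ?thesis
    by (simp add: poly_eval_sum poly_eval_single poly_eval_def[of p] poly_eval_def[of q]
        sum_product lookup_add power_add prod.distrib mult_ac)
qed

lemma poly_eval_rename_vars: "poly_eval (rename_vars \<sigma> p) z = poly_eval p (\<chi> i. z $ \<sigma> i)"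
proof -
  have "(\<Prod>k\<in>UNIV. (z $ k) ^ Poly_Mapping.lookup
           (\<Sum>i\<in>UNIV. Poly_Mapping.single (\<sigma> i) (Poly_Mapping.lookup m i)) k) =
        (\<Prod>i\<in>UNIV. (z $ \<sigma> i) ^ Poly_Mapping.lookup m i)" for m
  proof -
    have "(\<Prod>k\<in>UNIV. (z $ k) ^ Poly_Mapping.lookup
             (\<Sum>i\<in>UNIV. Poly_Mapping.single (\<sigma> i) (Poly_Mapping.lookup m i)) k) =
          (\<Prod>i\<in>UNIV. \<Prod>k\<in>UNIV. (z $ k) ^ (Poly_Mapping.lookup m i when \<sigma> i = k))"
      by (subst prod.swap) (simp add: lookup_sum lookup_single power_sum)
    also have "\<dots> = (\<Prod>i\<in>UNIV. (z $ \<sigma> i) ^ Poly_Mapping.lookup m i)"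
      by (intro prod.cong refl) (simp add: when_def if_distrib[of "(^) _"] prod.delta cong: if_cong)
    finally show ?thesis .
  qed
  then show ?thesis
    by (simp add: rename_vars_def poly_eval_sum poly_eval_single poly_eval_def[of p])
qed

lemma poly_eval_homogeneous:
  assumes "homogeneous d p"
  shows "poly_eval p (c *s z) = c ^ d * poly_eval p z"
proof -
  have "(\<Prod>i\<in>UNIV. (c * z $ i) ^ Poly_Mapping.lookup m i) =
      c ^ d * (\<Prod>i\<in>UNIV. (z $ i) ^ Poly_Mapping.lookup m i)" if "m \<in> Poly_Mapping.keys p" for m
    using assms that by (auto simp: homogeneous_def power_mult_distrib prod.distrib power_sum)
  then show ?thesis
    by (simp add: poly_eval_def sum_distrib_left mult_ac)
qed

lemma continuous_on_poly_eval [continuous_intros]: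
  "continuous_on S k \<Longrightarrow> continuous_on S (\<lambda>z. poly_eval p (k z))"
  unfolding poly_eval_def by (intro continuous_intros)

lemma scale_eq_0_iff: "c *s z = 0 \<longleftrightarrow> c = 0 \<or> z = (0 :: complex ^ 'n)"
  by (auto simp: vec_eq_iff)

lemma nonzero_coordinate:
  fixes x :: "complex ^ 'n"
  assumes "x \<noteq> 0"
  obtains i where "x $ i \<noteq> 0"
  using assms by (auto simp: vec_eq_iff)

lemma continuous_on_smult:
  assumes "continuous_on S c" "continuous_on S v"
  shows "continuous_on S (\<lambda>w. c w *s (v w :: complex ^ 'n))"
  unfolding vector_scalar_mult_def
  by (intro continuous_on_vec_lambda continuous_on_mult continuous_on_component assms)

text \<open>The two blocks of coordinates of a vector in \<open>\<complex>\<^sup>n \<times> \<complex>\<^sup>m\<close>.\<close>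

definition xpart :: "complex ^ ('n::finite + 'm::finite) \<Rightarrow> complex ^ 'n" where
  "xpart z = (\<chi> i. z $ Inl i)"

definition ypart :: "complex ^ ('n::finite + 'm::finite) \<Rightarrow> complex ^ 'm" where
  "ypart z = (\<chi> j. z $ Inr j)"

lemma xpart_nth [simp]: "xpart z $ i = z $ Inl i"
  and ypart_nth [simp]: "ypart z $ j = z $ Inr j"
  by (simp_all add: xpart_def ypart_def)

lemma vjoin_nth [simp]: "vjoin x y $ Inl i = x $ i" "vjoin x y $ Inr j = y $ j"
  by (simp_all add: vjoin_def)

lemma xpart_vjoin [simp]: "xpart (vjoin x y) = x"
  and ypart_vjoin [simp]: "ypart (vjoin x y) = y"
  by (simp_all add: vec_eq_iff)

lemma vjoin_parts: "vjoin (xpart z) (ypart z) = z"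
proof -
  have "vjoin (xpart z) (ypart z) $ k = z $ k" for k
    by (cases k) simp_all
  then show ?thesis by (simp add: vec_eq_iff)
qed

lemma xpart_scale [simp]: "xpart (c *s z) = c *s xpart z"
  and ypart_scale [simp]: "ypart (c *s z) = c *s ypart z"
  by (simp_all add: vec_eq_iff)

lemma vjoin_scale: "vjoin (c *s x) (c *s y) = c *s vjoin x y"
  by (metis vjoin_parts xpart_scale ypart_scale xpart_vjoin ypart_vjoin)

lemma vjoin_eq_0_iff: "vjoin x y = 0 \<longleftrightarrow> x = 0 \<and> y = 0"
  by (metis scale_eq_0_iff vjoin_scale xpart_vjoin ypart_vjoin)

lemma continuous_on_xpart [continuous_intros]:
    "continuous_on S k \<Longrightarrow> continuous_on S (\<lambda>w. xpart (k w))"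
  and continuous_on_ypart [continuous_intros]:
    "continuous_on S k \<Longrightarrow> continuous_on S (\<lambda>w. ypart (k w))"
  unfolding xpart_def ypart_def by (intro continuous_intros continuous_on_vec_lambda; assumption)+

lemma continuous_on_vjoin [continuous_intros]:
  assumes "continuous_on S k" "continuous_on S l"
  shows "continuous_on S (\<lambda>w. vjoin (k w) (l w))"
proof -
  have "continuous_on S (\<lambda>w. case i of Inl i \<Rightarrow> k w $ i | Inr j \<Rightarrow> l w $ j)" for i
    by (cases i) (auto intro!: continuous_intros assms)
  then show ?thesis
    unfolding vjoin_def by (intro continuous_on_vec_lambda)
qed

lemma poly_eval_sep_prod:
  "poly_eval (sep_prod f g) z = poly_eval f (xpart z) * poly_eval g (ypart z)"
  by (simp add: sep_prod_def poly_eval_mult poly_eval_rename_vars xpart_def ypart_def)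


section \<open>Projective space and complements of projective hypersurfaces\<close>

lemma hopf_eq_iff:
  assumes "z \<noteq> 0" "w \<noteq> 0"
  shows "hopf z = hopf w \<longleftrightarrow> (\<exists>c. c \<noteq> 0 \<and> w = c *s z)"
proof -
  have "proj_rel z z" "proj_rel w w"
    using assms by (auto simp: proj_rel_def intro!: exI[of _ 1])
  then have "hopf z = hopf w \<longleftrightarrow> proj_rel z w"
    using Quotient3_rel[OF Quotient3_cproj] by blast
  then show ?thesis
    using assms by (simp add: proj_rel_def)
qed

lemma hopf_scale: "c \<noteq> 0 \<Longrightarrow> z \<noteq> 0 \<Longrightarrow> hopf (c *s z) = hopf z"
  by (subst eq_commute, subst hopf_eq_iff) (auto simp: scale_eq_0_iff)

lemma hopf_rep: "hopf (rep_cproj p) = p" and rep_cproj_nonzero: "rep_cproj p \<noteq> 0"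
  using Quotient3_abs_rep[OF Quotient3_cproj] Quotient3_rep_reflp[OF Quotient3_cproj]
  by (auto simp: proj_rel_def)

lemma cproj_cases:
  obtains z where "z \<noteq> 0" "p = hopf z"
  by (metis hopf_rep rep_cproj_nonzero)

lemma rep_hopf:
  assumes "z \<noteq> 0"
  obtains c where "c \<noteq> 0" "rep_cproj (hopf z) = c *s z"
  using assms by (metis hopf_rep rep_cproj_nonzero hopf_eq_iff)

lemma affine_coord_hopf:
  assumes "z \<noteq> 0"
  shows "affine_coord i (hopf z) = inverse (z $ i) *s z"
proof (rule affine_coord.abs_eq)
  show "proj_rel z z"
    using assms by (auto simp: proj_rel_def intro!: exI[of _ 1])
qed

lemma hopf_mem_chart_iff:
  assumes "z \<noteq> 0"
  shows "hopf z \<in> hopf ` {z. z $ i \<noteq> 0} \<longleftrightarrow> z $ i \<noteq> 0"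
proof
  assume "hopf z \<in> hopf ` {z. z $ i \<noteq> 0}"
  then obtain w where w: "w $ i \<noteq> 0" "hopf z = hopf w" by auto
  then have "w \<noteq> 0" by auto
  then show "z $ i \<noteq> 0"
    using w assms by (auto simp: hopf_eq_iff)
qed auto

lemma hopf_chart_preimage:
  "{z. z \<noteq> 0 \<and> hopf z \<in> hopf ` {z. z $ i \<noteq> 0}} = {z. z $ i \<noteq> 0}"
  using hopf_mem_chart_iff by fastforce

lemma open_hopf_chart: "open (hopf ` {z :: complex ^ 'n::finite. z $ i \<noteq> 0})"
  unfolding open_cproj_def hopf_chart_preimage by (intro open_Collect_neq continuous_intros)

lemma affine_coord_inj: "inj_on (affine_coord i) (hopf ` {z. z $ i \<noteq> 0})"
proof (rule inj_onI)
  fix p q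
  assume "p \<in> hopf ` {z. z $ i \<noteq> 0}" "q \<in> hopf ` {z. z $ i \<noteq> 0}"
    and eq: "affine_coord i p = affine_coord i q"
  then obtain z w where z: "z $ i \<noteq> 0" "p = hopf z" and w: "w $ i \<noteq> 0" "q = hopf w" by auto
  have [simp]: "z \<noteq> 0" "w \<noteq> 0" using z w by auto
  have "hopf (inverse (z $ i) *s z) = hopf (inverse (w $ i) *s w)"
    using eq z w by (simp add: affine_coord_hopf)
  then show "p = q"
    using z w by (simp add: hopf_scale)
qed

lemma continuous_on_hopf: "continuous_on (- {0}) hopf"
proof -
  have "openin (top_of_set (- {0})) (- {0} \<inter> hopf -` U)" if "open U" for U :: "'a cproj set"
  proof -
    have "- {0} \<inter> hopf -` U = {z. z \<noteq> 0 \<and> hopf z \<in> U}" by auto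
    then show ?thesis
      using that by (simp add: open_cproj_def openin_open_eq open_Compl)
  qed
  then show ?thesis
    by (simp add: continuous_on_open_gen continuous_on_open_vimage open_Compl openin_open_eq Int_commute)
qed

text \<open>Continuity on an open subset of projective space may be checked in homogeneous
  coordinates.\<close>

lemma continuous_on_cprojI:
  fixes h :: "'n::finite cproj \<Rightarrow> 'b::topological_space"
  assumes S: "open {z. z \<noteq> 0 \<and> hopf z \<in> S}"
    and h: "continuous_on {z. z \<noteq> 0 \<and> hopf z \<in> S} (\<lambda>z. h (hopf z))"
  shows "continuous_on S h"
proof -
  have "open S"
    using S by (simp add: open_cproj_def)
  moreover have "open (h -` B \<inter> S)" if "open B" for B
  proof -
    have "open ((\<lambda>z. h (hopf z)) -` B \<inter> {z. z \<noteq> 0 \<and> hopf z \<in> S})"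
      using h that S by (simp add: continuous_on_open_vimage)
    also have "(\<lambda>z. h (hopf z)) -` B \<inter> {z. z \<noteq> 0 \<and> hopf z \<in> S} =
        {z. z \<noteq> 0 \<and> hopf z \<in> h -` B \<inter> S}" by auto
    finally show ?thesis by (simp add: open_cproj_def)
  qed
  ultimately show ?thesis
    by (simp add: continuous_on_open_vimage)
qed

lemma continuous_on_affine_coord: "continuous_on (hopf ` {z. z $ i \<noteq> 0}) (affine_coord i)"
proof (rule continuous_on_cprojI)
  show "open {z. z \<noteq> 0 \<and> hopf z \<in> hopf ` {z. z $ i \<noteq> 0}}"
    unfolding hopf_chart_preimage by (intro open_Collect_neq continuous_intros)
  have "continuous_on {z. z $ i \<noteq> 0} (\<lambda>z :: complex ^ 'a. \<chi> j. inverse (z $ i) * z $ j)"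
    by (intro continuous_on_vec_lambda continuous_on_mult continuous_on_inverse
        continuous_on_component continuous_on_id) auto
  then show "continuous_on {z. z \<noteq> 0 \<and> hopf z \<in> hopf ` {z. z $ i \<noteq> 0}} (\<lambda>z. affine_coord i (hopf z))"
    unfolding hopf_chart_preimage
    by (rule continuous_on_eq) (subst affine_coord_hopf, auto simp: vec_eq_iff)
qed

text \<open>The image \<open>F\<^sub>h\<^sup>*\<close> of the Milnor fiber is the complement of the projective hypersurface:
  a vector with \<open>h z \<noteq> 0\<close> can be rescaled to \<open>h z = 1\<close> since \<open>h\<close> has positive degree.\<close>

lemma hopf_mem_milnor_iff:
  assumes hom: "\<And>c z. poly_eval h (c *s z) = c ^ d * poly_eval h z" and "d > 0" and "z \<noteq> 0"
  shows "hopf z \<in> hopf ` milnor_fiber h \<longleftrightarrow> poly_eval h z \<noteq> 0"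
proof
  assume "hopf z \<in> hopf ` milnor_fiber h"
  then obtain w where w: "poly_eval h w = 1" "hopf z = hopf w"
    by (auto simp: milnor_fiber_def)
  have "w \<noteq> 0"
    using w(1) hom[of 0 0] \<open>d > 0\<close> by (auto simp: power_0_left)
  then show "poly_eval h z \<noteq> 0"
    using w hom \<open>z \<noteq> 0\<close> by (auto simp: hopf_eq_iff)
next
  assume nz: "poly_eval h z \<noteq> 0"
  define c where "c = exp (- Ln (poly_eval h z) / d)"
  have "c ^ d = exp (of_nat d * (- Ln (poly_eval h z) / of_nat d))"
    unfolding c_def by (rule exp_of_nat_mult[symmetric])
  then have "c ^ d = inverse (poly_eval h z)"
    using nz \<open>d > 0\<close> by (simp add: exp_minus)
  then have "c *s z \<in> milnor_fiber h"
    using nz by (simp add: milnor_fiber_def hom)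
  moreover have "hopf (c *s z) = hopf z"
    using \<open>z \<noteq> 0\<close> by (simp add: hopf_scale c_def)
  ultimately show "hopf z \<in> hopf ` milnor_fiber h"
    by (metis imageI)
qed


section \<open>Closure properties of smooth maps on open sets\<close>

lemma Ck_on_mono: "Ck_on (Suc k) f W \<Longrightarrow> Ck_on k f W"
proof (induction k arbitrary: f)
  case 0
  then have "f differentiable_on W"
    by (simp add: differentiable_on_def differentiable_at_withinI)
  then show ?case
    by (simp add: differentiable_imp_continuous_on)
next
  case (Suc k)
  show ?case
    unfolding Ck_on.simps(2)[of k]
  proof (intro conjI allI)
    show "\<forall>x\<in>W. f differentiable at x"
      using Suc.prems by (rule Ck_on.simps(2)[THEN iffD1, THEN conjunct1])
    show "Ck_on k (\<lambda>x. frechet_derivative f (at x) v) W" for v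
      by (rule Suc.IH) (rule Ck_on.simps(2)[THEN iffD1, OF Suc.prems, THEN conjunct2, THEN spec])
  qed
qed

lemma Ck_on_cong:
  assumes "open W" "Ck_on k f W" "\<And>x. x \<in> W \<Longrightarrow> f x = g x"
  shows "Ck_on k g W"
  using assms(2,3)
proof (induction k arbitrary: f g)
  case 0
  then show ?case
    using continuous_on_cong[of W W f g] by simp
next
  case (Suc k)
  have "g differentiable at x" if "x \<in> W" for x
  proof -
    have "f differentiable at x" using Suc.prems that by simp
    then obtain f' where "(f has_derivative f') (at x)"
      by (auto simp: differentiable_def)
    then have "(g has_derivative f') (at x)"
      using Suc.prems(2) by (rule has_derivative_transform_within_open[OF _ \<open>open W\<close> that]) auto
    then show ?thesis by (auto simp: differentiable_def)
  qed
  moreover have "Ck_on k (\<lambda>x. frechet_derivative g (at x) v) W" for v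
  proof (rule Suc.IH)
    show "Ck_on k (\<lambda>x. frechet_derivative f (at x) v) W"
      using Suc.prems by simp
    show "frechet_derivative f (at x) v = frechet_derivative g (at x) v" if "x \<in> W" for x
      using frechet_derivative_transform_within_open[of f x W g] Suc.prems \<open>open W\<close> that by simp
  qed
  ultimately show ?case by simp
qed

text \<open>An explicit formula for the derivative on \<open>W\<close> suffices. The inductive proofs of the closure
  properties below all use this rule: the formula is built from \<open>f\<close>, which is \<open>C\<^sup>k\<close> by
  \<open>Ck_on_mono\<close>, and from its derivatives, which are \<open>C\<^sup>k\<close> by definition.\<close>

lemma Ck_on_SucI:
  assumes "open W" "\<And>x. x \<in> W \<Longrightarrow> (f has_derivative f' x) (at x)"
    and "\<And>v. Ck_on k (\<lambda>x. f' x v) W"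
  shows "Ck_on (Suc k) f W"
  unfolding Ck_on.simps
proof (intro conjI ballI allI)
  show "f differentiable at x" if "x \<in> W" for x
    using assms(2)[OF that] by (auto simp: differentiable_def)
  show "Ck_on k (\<lambda>x. frechet_derivative f (at x) v) W" for v
  proof (rule Ck_on_cong[OF assms(1) assms(3)[of v]])
    show "f' x v = frechet_derivative f (at x) v" if "x \<in> W" for x
      by (simp add: frechet_derivative_at[OF assms(2)[OF that], symmetric])
  qed
qed

lemma Ck_on_has_derivative:
  "Ck_on (Suc k) f W \<Longrightarrow> x \<in> W \<Longrightarrow> (f has_derivative frechet_derivative f (at x)) (at x)"
  by (simp add: frechet_derivative_works)

lemma Ck_on_const: "Ck_on k (\<lambda>_. c) W"
  by (induction k arbitrary: c) auto

lemma Ck_on_bounded_linear: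
  assumes L: "bounded_linear L" and "open W" "Ck_on k f W"
  shows "Ck_on k (\<lambda>x. L (f x)) W"
  using assms(3)
proof (induction k arbitrary: f)
  case 0
  then show ?case by (simp add: bounded_linear.continuous_on[OF L])
next
  case (Suc k)
  show ?case
  proof (rule Ck_on_SucI[OF \<open>open W\<close>])
    show "((\<lambda>x. L (f x)) has_derivative (\<lambda>v. L (frechet_derivative f (at x) v))) (at x)" if "x \<in> W" for x
      by (rule bounded_linear.has_derivative[OF L Ck_on_has_derivative[OF Suc.prems that]])
    show "Ck_on k (\<lambda>x. L (frechet_derivative f (at x) v)) W" for v
      using Suc.prems by (intro Suc.IH) simp
  qed
qed

lemma Ck_on_ident: "open W \<Longrightarrow> Ck_on k (\<lambda>x. x) W"
proof (cases k)
  case (Suc l)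
  assume "open W"
  then show ?thesis
    unfolding Suc by (rule Ck_on_SucI) (rule has_derivative_ident, rule Ck_on_const)
qed simp

lemma Ck_on_add:
  assumes "open W" "Ck_on k f W" "Ck_on k g W"
  shows "Ck_on k (\<lambda>x. f x + g x) W"
  using assms(2,3)
proof (induction k arbitrary: f g)
  case 0
  then show ?case by (simp add: continuous_on_add)
next
  case (Suc k)
  show ?case
  proof (rule Ck_on_SucI[OF \<open>open W\<close>])
    show "((\<lambda>x. f x + g x) has_derivative
        (\<lambda>v. frechet_derivative f (at x) v + frechet_derivative g (at x) v)) (at x)" if "x \<in> W" for x
      by (intro has_derivative_add Ck_on_has_derivative[OF Suc.prems(1) that]
          Ck_on_has_derivative[OF Suc.prems(2) that])
    show "Ck_on k (\<lambda>x. frechet_derivative f (at x) v + frechet_derivative g (at x) v) W" for v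
      using Suc.prems by (intro Suc.IH) simp_all
  qed
qed

lemma Ck_on_sum:
  "open W \<Longrightarrow> (\<And>a. a \<in> A \<Longrightarrow> Ck_on k (f a) W) \<Longrightarrow> Ck_on k (\<lambda>x. \<Sum>a\<in>A. f a x) W"
  by (induction A rule: infinite_finite_induct) (simp_all add: Ck_on_const Ck_on_add)

lemma Ck_on_mult:
  fixes f g :: "'a::real_normed_vector \<Rightarrow> 'b::real_normed_algebra"
  assumes "open W" "Ck_on k f W" "Ck_on k g W"
  shows "Ck_on k (\<lambda>x. f x * g x) W"
  using assms(2,3)
proof (induction k arbitrary: f g)
  case 0
  then show ?case by (simp add: continuous_on_mult)
next
  case (Suc k)
  show ?case
  proof (rule Ck_on_SucI[OF \<open>open W\<close>])
    show "((\<lambda>x. f x * g x) has_derivative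
        (\<lambda>v. f x * frechet_derivative g (at x) v + frechet_derivative f (at x) v * g x)) (at x)"
      if "x \<in> W" for x
      by (intro has_derivative_mult Ck_on_has_derivative[OF Suc.prems(1) that]
          Ck_on_has_derivative[OF Suc.prems(2) that])
    show "Ck_on k (\<lambda>x. f x * frechet_derivative g (at x) v + frechet_derivative f (at x) v * g x) W" for v
      using Suc.prems Ck_on_mono[OF Suc.prems(1)] Ck_on_mono[OF Suc.prems(2)]
      by (intro Ck_on_add[OF \<open>open W\<close>] Suc.IH) simp_all
  qed
qed

lemma Ck_on_inverse:
  fixes f :: "'a::real_normed_vector \<Rightarrow> 'b::real_normed_div_algebra"
  assumes "open W" "Ck_on k f W" and nz: "\<And>x. x \<in> W \<Longrightarrow> f x \<noteq> 0"
  shows "Ck_on k (\<lambda>x. inverse (f x)) W"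
  using assms(2)
proof (induction k)
  case 0
  then show ?case using nz by (simp add: continuous_on_inverse)
next
  case (Suc k)
  show ?case
  proof (rule Ck_on_SucI[OF \<open>open W\<close>])
    show "((\<lambda>x. inverse (f x)) has_derivative
        (\<lambda>v. - (inverse (f x) * frechet_derivative f (at x) v * inverse (f x)))) (at x)"
      if "x \<in> W" for x
      by (rule Deriv.has_derivative_inverse[OF nz[OF that] Ck_on_has_derivative[OF Suc.prems that]])
    have "Ck_on k (\<lambda>x. inverse (f x)) W"
      by (rule Suc.IH[OF Ck_on_mono[OF Suc.prems]])
    then show "Ck_on k (\<lambda>x. - (inverse (f x) * frechet_derivative f (at x) v * inverse (f x))) W" for v
      using Suc.prems
      by (intro Ck_on_bounded_linear[OF bounded_linear_minus[OF bounded_linear_ident] \<open>open W\<close>]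
          Ck_on_mult[OF \<open>open W\<close>]) simp_all
  qed
qed

lemma Ck_on_Pair:
  assumes "open W" "Ck_on k f W" "Ck_on k g W"
  shows "Ck_on k (\<lambda>x. (f x, g x)) W"
proof -
  have "bounded_linear (\<lambda>a::'b. (a, 0::'c))" "bounded_linear (\<lambda>b::'c. (0::'b, b))"
    by (intro bounded_linear_Pair bounded_linear_ident bounded_linear_zero)+
  note lin = this[THEN Ck_on_bounded_linear, OF \<open>open W\<close>]
  have "Ck_on k (\<lambda>x. (f x, 0) + (0, g x)) W"
    by (intro Ck_on_add[OF \<open>open W\<close>] lin assms(2,3))
  then show ?thesis by simp
qed

lemma bounded_linear_axis: "bounded_linear (axis i :: 'b::real_normed_vector \<Rightarrow> 'b ^ 'n)"
proof (rule bounded_linear_intro[where K = 1])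
  show "norm (axis i x :: 'b ^ 'n) \<le> norm x * 1" for x :: 'b
  proof -
    have "norm (axis i x :: 'b ^ 'n) \<le> (\<Sum>j\<in>UNIV. norm ((axis i x :: 'b ^ 'n) $ j))"
      unfolding norm_vec_def by (rule L2_set_le_sum) simp
    also have "\<dots> = (\<Sum>j\<in>UNIV. if j = i then norm x else 0)"
      by (rule sum.cong) (simp_all add: axis_def)
    finally show ?thesis by simp
  qed
qed (simp_all add: axis_def vec_eq_iff)

lemma Ck_on_vec_lambda:
  fixes f :: "'n::finite \<Rightarrow> 'a::real_normed_vector \<Rightarrow> 'b::real_normed_vector"
  assumes "open W" "\<And>i. Ck_on k (f i) W"
  shows "Ck_on k (\<lambda>x. \<chi> i. f i x) W"
proof -
  have "(\<chi> i. f i x) = (\<Sum>i\<in>UNIV. axis i (f i x))" for x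
    by (simp add: vec_eq_iff axis_def if_distrib cong: if_cong)
  moreover have "Ck_on k (\<lambda>x. \<Sum>i\<in>UNIV. axis i (f i x)) W"
    by (intro Ck_on_sum Ck_on_bounded_linear[OF bounded_linear_axis] assms)
  ultimately show ?thesis by simp
qed

lemmas Ck_on_nth = Ck_on_bounded_linear[OF bounded_linear_vec_nth]
lemmas Ck_on_fst = Ck_on_bounded_linear[OF bounded_linear_fst]
lemmas Ck_on_snd = Ck_on_bounded_linear[OF bounded_linear_snd]

lemma Ck_on_smult:
  assumes "open W" "Ck_on k c W" "Ck_on k f W"
  shows "Ck_on k (\<lambda>x. c x *s (f x :: complex ^ 'n::finite)) W"
  unfolding vector_scalar_mult_def
  by (intro Ck_on_vec_lambda Ck_on_mult Ck_on_nth assms)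

section \<open>Smooth maps in charts\<close>

text \<open>A map \<open>h\<close> is smooth in given charts when its coordinate expression \<open>G\<close> extends smoothly to an
  open set of the ambient vector space, which is bigger than the affine subspace that contains the
  image of the chart. Inverse charts need not be computed.\<close>

lemma smooth_on_chartI:
  assumes "inj_on \<phi> U" "S \<subseteq> U" "open W" "\<And>k. Ck_on k G W"
    and "\<And>p. p \<in> S \<Longrightarrow> \<phi> p \<in> W \<and> G (\<phi> p) = \<psi> (h p)"
  shows "smooth_on (\<phi> ` S) (\<psi> \<circ> h \<circ> inv_into U \<phi>)"
  unfolding smooth_on_def
proof (intro ballI exI conjI allI)
  fix x assume "x \<in> \<phi> ` S"
  then show "x \<in> W" using assms(5) by auto
next
  fix y assume "y \<in> \<phi> ` S \<inter> W"
  then show "G y = (\<psi> \<circ> h \<circ> inv_into U \<phi>) y"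
    using assms(1,2,5) by (auto simp: inv_into_f_f subset_iff)
qed (use assms in auto)

lemma smooth_mapI:
  assumes "h \<in> pts M \<rightarrow> pts N" "continuous_on (pts M) h"
    and "\<And>U \<phi> V \<psi>. (U, \<phi>) \<in> charts M \<Longrightarrow> (V, \<psi>) \<in> charts N \<Longrightarrow>
      smooth_on (\<phi> ` {p \<in> pts M \<inter> U. h p \<in> V}) (\<psi> \<circ> h \<circ> inv_into U \<phi>)"
  shows "smooth_map M N h"
  unfolding smooth_map_def
proof (intro conjI assms(1,2))
  show "\<forall>(U, \<phi>)\<in>charts M. \<forall>(V, \<psi>)\<in>charts N.
      smooth_on (\<phi> ` {p \<in> pts M \<inter> U. h p \<in> V}) (\<psi> \<circ> h \<circ> inv_into U \<phi>)"
    by clarify (rule assms(3))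
qed

lemma smooth_map_cong:
  assumes "smooth_map M N h" "\<And>p. p \<in> pts M \<Longrightarrow> h p = h' p"
    and inj: "\<And>U \<phi>. (U, \<phi>) \<in> charts M \<Longrightarrow> inj_on \<phi> U"
  shows "smooth_map M N h'"
proof (rule smooth_mapI)
  show "h' \<in> pts M \<rightarrow> pts N" "continuous_on (pts M) h'"
    using assms(1,2) by (auto simp: smooth_map_def Pi_iff cong: continuous_on_cong)
next
  fix U \<phi> V \<psi> assume chart: "(U, \<phi>) \<in> charts M" "(V, \<psi>) \<in> charts N"
  have S: "{p \<in> pts M \<inter> U. h p \<in> V} = {p \<in> pts M \<inter> U. h' p \<in> V}"
    using assms(2) by auto
  have "smooth_on (\<phi> ` {p \<in> pts M \<inter> U. h p \<in> V}) (\<psi> \<circ> h \<circ> inv_into U \<phi>)"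
    using assms(1) chart by (auto simp: smooth_map_def)
  moreover have "(\<psi> \<circ> h \<circ> inv_into U \<phi>) y = (\<psi> \<circ> h' \<circ> inv_into U \<phi>) y"
    if "y \<in> \<phi> ` {p \<in> pts M \<inter> U. h p \<in> V}" for y
    using that assms(2) inj[OF chart(1)] by (auto simp: inv_into_f_f)
  ultimately have "smooth_on (\<phi> ` {p \<in> pts M \<inter> U. h p \<in> V}) (\<psi> \<circ> h' \<circ> inv_into U \<phi>)"
    unfolding smooth_on_def by (metis (no_types, lifting) IntD1)
  then show "smooth_on (\<phi> ` {p \<in> pts M \<inter> U. h' p \<in> V}) (\<psi> \<circ> h' \<circ> inv_into U \<phi>)"
    unfolding S .
qed

text \<open>Charts are assumed injective so that \<^const>\<open>inv_into\<close> recovers the points of \<open>pts N\<close> from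
  their coordinates.\<close>

lemma diffeomorphismI:
  assumes "smooth_map M N h" "smooth_map N M k"
    and kh: "\<And>p. p \<in> pts M \<Longrightarrow> k (h p) = p" and hk: "\<And>q. q \<in> pts N \<Longrightarrow> h (k q) = q"
    and inj: "\<And>U \<phi>. (U, \<phi>) \<in> charts N \<Longrightarrow> inj_on \<phi> U"
  shows "diffeomorphism M N h"
proof -
  have maps: "h \<in> pts M \<rightarrow> pts N" "k \<in> pts N \<rightarrow> pts M"
    using assms(1,2) by (auto simp: smooth_map_def)
  have bij: "bij_betw h (pts M) (pts N)"
    by (rule bij_betw_byWitness[where f' = k]) (use kh hk maps in auto)
  have "k q = inv_into (pts M) h q" if "q \<in> pts N" for q
    using that maps hk bij by (metis Pi_mem bij_betw_inv_into_left)
  then have "smooth_map N M (inv_into (pts M) h)"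
    by (rule smooth_map_cong[OF assms(2) _ inj])
  then show ?thesis
    using bij assms(1) by (simp add: diffeomorphism_def)
qed


section \<open>Monodromy and maps that are constant up to homotopy along transport\<close>

lemma homotopic_with_canonI:
  assumes "continuous_on ({0..1::real} \<times> S) H" "H \<in> {0..1} \<times> S \<rightarrow> T"
    and "\<And>x. x \<in> S \<Longrightarrow> H (0, x) = p x" "\<And>x. x \<in> S \<Longrightarrow> H (1, x) = q x"
  shows "homotopic_with_canon (\<lambda>_. True) S T p q"
  using assms by (subst homotopic_with) (auto intro!: exI[of _ H])

lemma homotopic_with_canonE:
  assumes "homotopic_with_canon (\<lambda>_. True) S T p q"
  obtains H where "continuous_on ({0..1::real} \<times> S) H" "H \<in> {0..1} \<times> S \<rightarrow> T"
    "\<And>x. H (0, x) = p x" "\<And>x. H (1, x) = q x"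
  using assms unfolding homotopic_with_def by auto

lemma local_trivialization_props:
  assumes "local_trivialization M N F \<pi> U \<phi>"
  defines "X \<equiv> pts M \<inter> \<pi> -` U"
  shows "U \<subseteq> pts N" "bij_betw \<phi> X (U \<times> pts F)" "continuous_on X \<phi>"
    "continuous_on (U \<times> pts F) (inv_into X \<phi>)" "\<And>p. p \<in> X \<Longrightarrow> fst (\<phi> p) = \<pi> p"
proof -
  show "U \<subseteq> pts N"
    using assms(1) by (auto simp: local_trivialization_def dest: openin_imp_subset)
  then have "pts N \<inter> U = U" by auto
  then show "bij_betw \<phi> X (U \<times> pts F)" "continuous_on X \<phi>"
    "continuous_on (U \<times> pts F) (inv_into X \<phi>)" "\<And>p. p \<in> X \<Longrightarrow> fst (\<phi> p) = \<pi> p"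
    using assms(1)
    by (auto simp: local_trivialization_def diffeomorphism_def smooth_map_def X_def
        restrict_mfd_def prod_mfd_def)
qed

lemma transport_le: "transport M N F \<pi> \<gamma> s t h \<Longrightarrow> s \<le> t"
  by (induction rule: transport.induct) auto

text \<open>A point transported along \<open>\<gamma>\<close> traces a path in the total space, depending continuously on the
  point. Hence a continuous map \<open>E\<close> on the total space changes only by a homotopy when it is
  precomposed with transport.\<close>

lemma transport_homotopic:
  assumes "transport M N F \<pi> \<gamma> s t h" "continuous_on {0..1} \<gamma>" "0 \<le> s" "t \<le> 1"
    and E: "continuous_on (pts M) E" "E \<in> pts M \<rightarrow> Z"
  defines "fib \<equiv> \<lambda>u. pts M \<inter> \<pi> -` {\<gamma> u}"
  shows "continuous_on (fib s) h \<and> h \<in> fib s \<rightarrow> fib t \<and>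
    homotopic_with_canon (\<lambda>_. True) (fib s) Z E (E \<circ> h)"
  using assms(1,3,4)
proof (induction rule: transport.induct)
  case (step s t U \<phi>)
  define X where "X = pts M \<inter> \<pi> -` U"
  note triv = local_trivialization_props[OF step(2), folded X_def]
  \<comment> \<open>Transport of \<open>p\<close> from time \<open>s\<close> to time \<open>u\<close> inside one trivialization.\<close>
  define T where "T = (\<lambda>(u, p). inv_into X \<phi> (\<gamma> u, snd (\<phi> p)))"
  have fib: "fib s \<subseteq> X"
    using step(1,3) by (auto simp: fib_def X_def image_subset_iff)
  have snd_F: "snd (\<phi> p) \<in> pts F" if "p \<in> X" for p
    using bij_betw_apply[OF triv(2) that] by (simp add: mem_Times_iff)
  have T_fib: "T (u, p) \<in> fib u" if "u \<in> {s..t}" "p \<in> X" for u p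
  proof -
    have *: "(\<gamma> u, snd (\<phi> p)) \<in> U \<times> pts F"
      using step(3) that snd_F by auto
    then have "T (u, p) \<in> X" "\<phi> (T (u, p)) = (\<gamma> u, snd (\<phi> p))"
      using triv(2) by (auto simp: T_def bij_betw_inv_into_right[OF triv(2) *]
          intro: bij_betw_apply[OF bij_betw_inv_into[OF triv(2)]])
    then show ?thesis
      using triv(5)[of "T (u, p)"] by (auto simp: fib_def X_def)
  qed
  have T_s: "T (s, p) = p" if "p \<in> fib s" for p
  proof -
    have "(\<gamma> s, snd (\<phi> p)) = \<phi> p"
      using triv(5)[of p] that fib by (auto simp: fib_def prod_eq_iff)
    then show ?thesis
      using that fib by (auto simp: T_def bij_betw_inv_into_left[OF triv(2)])
  qed
  have cont: "continuous_on ({s..t} \<times> fib s) T"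
    unfolding T_def case_prod_beta
  proof (rule continuous_on_compose2[OF triv(4)])
    show "continuous_on ({s..t} \<times> fib s) (\<lambda>x. (\<gamma> (fst x), snd (\<phi> (snd x))))"
    proof (intro continuous_on_Pair continuous_on_snd)
      show "continuous_on ({s..t} \<times> fib s) (\<lambda>x. \<gamma> (fst x))"
        by (rule continuous_on_compose2[OF assms(2)])
          (use step.prems in \<open>auto intro!: continuous_intros\<close>)
      show "continuous_on ({s..t} \<times> fib s) (\<lambda>x. \<phi> (snd x))"
        by (rule continuous_on_compose2[OF triv(3)])
          (use fib in \<open>auto intro!: continuous_intros\<close>)
    qed
    show "(\<lambda>x. (\<gamma> (fst x), snd (\<phi> (snd x)))) ` ({s..t} \<times> fib s) \<subseteq> U \<times> pts F"
      using step(3) fib snd_F by auto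
  qed
  let ?h = "\<lambda>p. inv_into (pts M \<inter> \<pi> -` U) \<phi> (\<gamma> t, snd (\<phi> p))"
  have h: "?h = (\<lambda>p. T (t, p))"
    by (simp add: T_def X_def)
  have "continuous_on (fib s) ?h"
    unfolding h by (rule continuous_on_compose2[OF cont]) (use step(1) in \<open>auto intro!: continuous_intros\<close>)
  moreover have "?h \<in> fib s \<rightarrow> fib t"
    unfolding h using T_fib fib step(1) by auto
  moreover have "homotopic_with_canon (\<lambda>_. True) (fib s) Z E (E \<circ> ?h)"
  proof (rule homotopic_with_canonI[where H = "\<lambda>(u, p). E (T (s + u * (t - s), p))"])
    have u: "s + u * (t - s) \<in> {s..t}" if "u \<in> {0..1}" for u
      using that step(1) mult_right_mono[of u 1 "t - s"] by auto
    then have T_M: "T (s + u * (t - s), p) \<in> pts M" if "u \<in> {0..1}" "p \<in> fib s" for u p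
      using T_fib[OF u, of u p] that fib by (auto simp: fib_def)
    show "continuous_on ({0..1} \<times> fib s) (\<lambda>(u, p). E (T (s + u * (t - s), p)))"
      unfolding case_prod_beta
      by (intro continuous_on_compose2[OF E(1)] continuous_on_compose2[OF cont] continuous_intros)
        (use u T_M in auto)
    show "(\<lambda>(u, p). E (T (s + u * (t - s), p))) \<in> {0..1} \<times> fib s \<rightarrow> Z"
      using E(2) T_M by auto
  qed (use T_s h in auto)
  ultimately show ?case by blast
next
  case (comp s t h u k)
  have "s \<le> t" "t \<le> u"
    using comp.hyps by (auto dest: transport_le)
  then have "0 \<le> t" "t \<le> 1"
    using comp.prems by auto
  note h = comp.IH(1)[OF comp.prems(1) \<open>t \<le> 1\<close>] and k = comp.IH(2)[OF \<open>0 \<le> t\<close> comp.prems(2)]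
  have "homotopic_with_canon (\<lambda>_. True) (fib s) Z (E \<circ> h) ((E \<circ> k) \<circ> h)"
    by (rule homotopic_with_compose_continuous_map_right[OF k[THEN conjunct2, THEN conjunct2]])
      (use h in auto)
  then have "homotopic_with_canon (\<lambda>_. True) (fib s) Z E (E \<circ> (k \<circ> h))"
    using homotopic_with_trans h by (metis o_assoc)
  moreover have "continuous_on (fib s) (k \<circ> h)"
    by (rule continuous_on_compose[OF h[THEN conjunct1] continuous_on_subset[OF k[THEN conjunct1]]])
      (use h in auto)
  moreover have "k \<circ> h \<in> fib s \<rightarrow> fib u"
    using h k by auto
  ultimately show ?case
    by blast
qed

text \<open>The degree of a self-map of \<open>\<complex>\<^sup>*\<close> is detected after composing with a nonconstant power.
  Here the degree is handled through logarithms: \<open>(k t / t)\<^sup>N\<close> is null-homotopic, hence has a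
  continuous \<open>N\<close>-th root \<open>exp (G t / N)\<close>, which differs from \<open>k t / t\<close> by an \<open>N\<close>-th root of unity
  that is constant on the connected set \<open>\<complex>\<^sup>*\<close>.\<close>

lemma homotopic_id_if_power_homotopic:
  fixes k :: "complex \<Rightarrow> complex"
  assumes k: "continuous_on (- {0}) k" "k \<in> - {0} \<rightarrow> - {0}" and "N > 0" "c \<noteq> 0"
    and hom: "homotopic_with_canon (\<lambda>_. True) (- {0}) (- {0}) (\<lambda>t. c * t ^ N) (\<lambda>t. c * k t ^ N)"
  shows "homotopic_with_canon (\<lambda>_. True) (- {0}) (- {0}) k id"
proof -
  obtain H where H: "continuous_on ({0..1::real} \<times> - {0}) H" "H \<in> {0..1} \<times> - {0} \<rightarrow> - {0}"
    "\<And>t. H (0, t) = c * t ^ N" "\<And>t. H (1, t) = c * k t ^ N"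
    using homotopic_with_canonE[OF hom] by blast
  have "homotopic_with_canon (\<lambda>_. True) (- {0}) (- {0}) (\<lambda>t. 1) (\<lambda>t. (k t / t) ^ N)"
  proof (rule homotopic_with_canonI[where H = "\<lambda>x. H x / (c * snd x ^ N)"])
    show "continuous_on ({0..1} \<times> - {0}) (\<lambda>x. H x / (c * snd x ^ N))"
      using \<open>c \<noteq> 0\<close> by (auto intro!: continuous_intros H(1))
    show "(\<lambda>x. H x / (c * snd x ^ N)) \<in> {0..1} \<times> - {0} \<rightarrow> - {0}"
      using H(2) \<open>c \<noteq> 0\<close> by fastforce
  qed (use H(3,4) \<open>c \<noteq> 0\<close> in \<open>auto simp: power_divide\<close>)
  then obtain G where G: "continuous_on (- {0}) G" "\<And>t. t \<noteq> 0 \<Longrightarrow> (k t / t) ^ N = exp (G t)"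
    using inessential_eq_continuous_logarithm[of "- {0}" "\<lambda>t. (k t / t) ^ N"]
      homotopic_with_symD by fastforce
  \<comment> \<open>The quotient of \<open>k t / t\<close> by the continuous root.\<close>
  define w where "w t = k t / t / exp (G t / of_nat N)" for t
  have w_root: "w t ^ N = 1" if "t \<noteq> 0" for t
  proof -
    have "w t ^ N = (k t / t) ^ N / exp (G t / of_nat N) ^ N"
      by (simp only: w_def power_divide)
    also have "exp (G t / of_nat N) ^ N = exp (G t)"
      using \<open>N > 0\<close> by (simp add: exp_of_nat_mult[symmetric])
    finally show ?thesis
      by (simp only: G(2)[OF that]) simp
  qed
  have "w constant_on (- {0})"
  proof (rule continuous_finite_range_constant)
    show "connected (- {0 :: complex})"
      by (intro connected_punctured_universe) simp
    show "continuous_on (- {0}) w"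
      unfolding w_def by (intro continuous_intros k(1) G(1)) (use \<open>N > 0\<close> in auto)
    have "w ` (- {0}) \<subseteq> {z. z ^ N = 1}"
      using w_root by auto
    then show "finite (w ` (- {0}))"
      using \<open>N > 0\<close> finite_roots_unity[of N] finite_subset by (metis Suc_leI One_nat_def)
  qed
  then obtain \<omega> where w: "\<And>t. t \<noteq> 0 \<Longrightarrow> w t = \<omega>"
    by (auto simp: constant_on_def)
  have "\<omega> \<noteq> 0"
    using w[of 1] w_root[of 1] \<open>N > 0\<close> by (auto simp: power_0_left)
  define L where "L t = G t / of_nat N + Ln \<omega>" for t
  have k_eq: "k t = t * exp (L t)" if "t \<noteq> 0" for t
    using w[OF that] that \<open>\<omega> \<noteq> 0\<close> by (auto simp: w_def L_def exp_add field_simps)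
  have L: "continuous_on (- {0}) L"
    unfolding L_def by (intro continuous_intros G(1)) (use \<open>N > 0\<close> in simp_all)
  show ?thesis
  proof (rule homotopic_with_canonI[where H = "\<lambda>(u, t). t * exp (of_real (1 - u) * L t)"])
    show "continuous_on ({0..1} \<times> - {0}) (\<lambda>(u, t). t * exp (of_real (1 - u) * L t))"
      unfolding case_prod_beta
      by (intro continuous_intros continuous_on_compose2[OF L]) auto
  qed (use k_eq in auto)
qed


section \<open>The projection and its local trivializations\<close>

text \<open>The map \<open>[x : y] \<mapsto> ([x], [y])\<close>, computed on an arbitrary representative. It is meaningful
  only where both blocks are nonzero.\<close>

definition sep_proj :: "('n::finite + 'm::finite) cproj \<Rightarrow> 'n cproj \<times> 'm cproj" where
  "sep_proj p = (hopf (xpart (rep_cproj p)), hopf (ypart (rep_cproj p)))"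

lemma sep_proj_hopf:
  assumes "x \<noteq> 0" "y \<noteq> 0"
  shows "sep_proj (hopf (vjoin x y)) = (hopf x, hopf y)"
proof -
  have "vjoin x y \<noteq> 0"
    using assms by (metis scale_eq_0_iff xpart_scale xpart_vjoin)
  then obtain c where "c \<noteq> 0" "rep_cproj (hopf (vjoin x y)) = c *s vjoin x y"
    by (rule rep_hopf)
  then show ?thesis
    using assms by (simp add: sep_proj_def hopf_scale)
qed

text \<open>The trivialization over \<open>{x\<^sub>i \<noteq> 0} \<times> {y\<^sub>j \<noteq> 0}\<close>: its fiber coordinate is \<open>y\<^sub>j / x\<^sub>i\<close>, read off from
  the affine chart at \<open>x\<^sub>i\<close>. The inverse takes \<open>([x], [y], t)\<close> to \<open>[x / x\<^sub>i : t y / y\<^sub>j]\<close>.\<close>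

definition triv :: "'n \<Rightarrow> 'm \<Rightarrow> ('n::finite + 'm::finite) cproj \<Rightarrow> ('n cproj \<times> 'm cproj) \<times> complex" where
  "triv i j p = (sep_proj p, affine_coord (Inl i) p $ Inr j)"

definition triv_inv :: "'n \<Rightarrow> 'm \<Rightarrow> ('n cproj \<times> 'm cproj) \<times> complex \<Rightarrow> ('n::finite + 'm::finite) cproj" where
  "triv_inv i j = (\<lambda>((a, b), t). hopf (vjoin (affine_coord i a) (t *s affine_coord j b)))"

lemma triv_hopf:
  assumes "x $ i \<noteq> 0" "y $ j \<noteq> 0"
  shows "triv i j (hopf (vjoin x y)) = ((hopf x, hopf y), y $ j / x $ i)"
proof -
  have [simp]: "x \<noteq> 0" "y \<noteq> 0"
    using assms by auto
  show ?thesis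
    by (simp add: triv_def sep_proj_hopf affine_coord_hopf vjoin_eq_0_iff field_simps)
qed

text \<open>Multiplication by \<open>x\<^sub>i y\<^sub>j\<close> gives a representative that is polynomial in \<open>x\<close>, \<open>y\<close> and \<open>t\<close>.\<close>

lemma triv_inv_hopf:
  assumes "x $ i \<noteq> 0" "y $ j \<noteq> 0"
  shows "triv_inv i j ((hopf x, hopf y), t) = hopf (vjoin (y $ j *s x) ((t * x $ i) *s y))"
proof -
  have [simp]: "x \<noteq> 0" "y \<noteq> 0"
    using assms by auto
  define v where "v = vjoin (y $ j *s x) ((t * x $ i) *s y)"
  have "vjoin (inverse (x $ i) *s x) (t *s (inverse (y $ j) *s y)) = inverse (x $ i * y $ j) *s v"
    using assms by (simp add: v_def vjoin_scale[symmetric] vector_smult_assoc field_simps)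
  moreover have "v \<noteq> 0"
    using assms by (simp add: v_def vjoin_eq_0_iff scale_eq_0_iff)
  ultimately show ?thesis
    using assms by (simp add: triv_inv_def affine_coord_hopf hopf_scale flip: v_def)
qed

locale separated_polys =
  fixes f :: "'n::finite cpoly" and g :: "'m::finite cpoly" and r s :: nat
  assumes r: "r > 0" and s: "s > 0" and hom_f: "homogeneous r f" and hom_g: "homogeneous s g"
begin

text \<open>Total space \<open>F\<^sub>f\<^sub>g\<^sup>*\<close>, base \<open>F\<^sub>f\<^sup>* \<times> F\<^sub>g\<^sup>*\<close> and fiber \<open>\<complex>\<^sup>*\<close>.\<close>

definition total_mfd :: "(('n + 'm) cproj, complex ^ ('n + 'm)) mfd" where
  "total_mfd = restrict_mfd proj_mfd (hopf ` milnor_fiber (sep_prod f g))"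

definition base_mfd :: "('n cproj \<times> 'm cproj, (complex ^ 'n) \<times> (complex ^ 'm)) mfd" where
  "base_mfd = prod_mfd (restrict_mfd proj_mfd (hopf ` milnor_fiber f))
                   (restrict_mfd proj_mfd (hopf ` milnor_fiber g))"

definition fiber_mfd :: "(complex, complex) mfd" where
  "fiber_mfd = restrict_mfd euclidean_mfd (- {0})"

lemma eval_f: "poly_eval f (c *s x) = c ^ r * poly_eval f x"
  and eval_g: "poly_eval g (c *s y) = c ^ s * poly_eval g y"
  using poly_eval_homogeneous hom_f hom_g by auto

lemma f_nonzero: "poly_eval f x \<noteq> 0 \<Longrightarrow> x \<noteq> 0"
  and g_nonzero: "poly_eval g y \<noteq> 0 \<Longrightarrow> y \<noteq> 0"
  using eval_f[of 0 0] eval_g[of 0 0] r s by (auto simp: power_0_left)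

lemma pts_total_iff:
  assumes "z \<noteq> 0"
  shows "hopf z \<in> pts total_mfd \<longleftrightarrow> poly_eval f (xpart z) \<noteq> 0 \<and> poly_eval g (ypart z) \<noteq> 0"
proof -
  have "poly_eval (sep_prod f g) (c *s w) = c ^ (r + s) * poly_eval (sep_prod f g) w" for c w
    by (simp add: poly_eval_sep_prod eval_f eval_g power_add)
  then show ?thesis
    using hopf_mem_milnor_iff[of "sep_prod f g" "r + s" z] assms r
    by (simp add: total_mfd_def restrict_mfd_def proj_mfd_def poly_eval_sep_prod)
qed

lemma pts_base_iff:
  assumes "x \<noteq> 0" "y \<noteq> 0"
  shows "(hopf x, hopf y) \<in> pts base_mfd \<longleftrightarrow> poly_eval f x \<noteq> 0 \<and> poly_eval g y \<noteq> 0"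
  using assms hopf_mem_milnor_iff[OF eval_f r] hopf_mem_milnor_iff[OF eval_g s]
  by (simp add: base_mfd_def restrict_mfd_def proj_mfd_def prod_mfd_def)

lemma pts_fiber: "pts fiber_mfd = - {0}"
  by (simp add: fiber_mfd_def restrict_mfd_def euclidean_mfd_def)

lemma total_cases:
  assumes "p \<in> pts total_mfd"
  obtains x y where "p = hopf (vjoin x y)" "poly_eval f x \<noteq> 0" "poly_eval g y \<noteq> 0"
    "x \<noteq> 0" "y \<noteq> 0" "vjoin x y \<noteq> 0"
proof -
  obtain z where z: "z \<noteq> 0" "p = hopf z" by (rule cproj_cases)
  show thesis
    using that[of "xpart z" "ypart z"] z assms pts_total_iff f_nonzero g_nonzero
    by (auto simp: vjoin_parts)
qed

lemma base_cases:
  assumes "q \<in> pts base_mfd"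
  obtains x y where "q = (hopf x, hopf y)" "poly_eval f x \<noteq> 0" "poly_eval g y \<noteq> 0"
    "x \<noteq> 0" "y \<noteq> 0"
proof -
  obtain a b where q: "q = (a, b)" by (cases q)
  obtain x where "x \<noteq> 0" "a = hopf x" by (rule cproj_cases)
  moreover obtain y where "y \<noteq> 0" "b = hopf y" by (rule cproj_cases)
  ultimately show thesis
    using that[of x y] assms pts_base_iff[of x y] q by auto
qed

lemma total_preimage:
  "{z. z \<noteq> 0 \<and> hopf z \<in> pts total_mfd} =
    {z. poly_eval f (xpart z) \<noteq> 0} \<inter> {z. poly_eval g (ypart z) \<noteq> 0}"
  using pts_total_iff f_nonzero by (fastforce simp: xpart_def vec_eq_iff)

lemma charts_total: "charts total_mfd = {(hopf ` {z. z $ k \<noteq> 0}, affine_coord k) | k. True}"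
  by (simp add: total_mfd_def restrict_mfd_def proj_mfd_def)

lemma charts_base: "charts base_mfd =
    {(hopf ` {x. x $ i \<noteq> 0} \<times> hopf ` {y. y $ j \<noteq> 0}, map_prod (affine_coord i) (affine_coord j)) | i j. True}"
  unfolding base_mfd_def prod_mfd_def restrict_mfd_def proj_mfd_def mfd.sel by blast

lemma charts_fiber: "charts fiber_mfd = {(UNIV, id)}"
  by (simp add: fiber_mfd_def restrict_mfd_def euclidean_mfd_def)

lemma sep_proj_total: "sep_proj \<in> pts total_mfd \<rightarrow> pts base_mfd"
  by (auto elim!: total_cases simp: sep_proj_hopf pts_base_iff)

lemma smooth_sep_proj: "smooth_map total_mfd base_mfd sep_proj"
proof (rule smooth_mapI)
  show "sep_proj \<in> pts total_mfd \<rightarrow> pts base_mfd"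
    by (rule sep_proj_total)
  show "continuous_on (pts total_mfd) sep_proj"
  proof (rule continuous_on_cprojI)
    show "open {z. z \<noteq> 0 \<and> hopf z \<in> pts total_mfd}"
      unfolding total_preimage by (intro open_Int open_Collect_neq continuous_intros)
    have "continuous_on ({z. poly_eval f (xpart z) \<noteq> 0} \<inter> {z. poly_eval g (ypart z) \<noteq> 0})
        (\<lambda>z. (hopf (xpart z), hopf (ypart z)))"
      by (intro continuous_on_Pair continuous_on_compose2[OF continuous_on_hopf] continuous_intros)
        (auto dest: f_nonzero g_nonzero)
    then show "continuous_on {z. z \<noteq> 0 \<and> hopf z \<in> pts total_mfd} (\<lambda>z. sep_proj (hopf z))"
      unfolding total_preimage
    proof (rule continuous_on_eq)
      fix z assume "z \<in> {z. poly_eval f (xpart z) \<noteq> 0} \<inter> {z. poly_eval g (ypart z) \<noteq> 0}"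
      then show "(hopf (xpart z), hopf (ypart z)) = sep_proj (hopf z)"
        using sep_proj_hopf[of "xpart z" "ypart z"] f_nonzero g_nonzero by (simp add: vjoin_parts)
    qed
  qed
next
  fix U \<phi> V \<psi> assume "(U, \<phi>) \<in> charts total_mfd" "(V, \<psi>) \<in> charts base_mfd"
  then obtain k i j where U: "U = hopf ` {z. z $ k \<noteq> 0}" "\<phi> = affine_coord k"
    and V: "V = hopf ` {x. x $ i \<noteq> 0} \<times> hopf ` {y. y $ j \<noteq> 0}"
      "\<psi> = map_prod (affine_coord i) (affine_coord j)"
    by (auto simp: charts_total charts_base)
  define W where "W = {w :: complex ^ ('n + 'm). w $ Inl i \<noteq> 0} \<inter> {w. w $ Inr j \<noteq> 0}"
  define G where "G = (\<lambda>w :: complex ^ ('n + 'm).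
    (inverse (w $ Inl i) *s xpart w, inverse (w $ Inr j) *s ypart w))"
  have W: "open W"
    unfolding W_def by (intro open_Int open_Collect_neq continuous_intros)
  show "smooth_on (\<phi> ` {p \<in> pts total_mfd \<inter> U. sep_proj p \<in> V}) (\<psi> \<circ> sep_proj \<circ> inv_into U \<phi>)"
  proof (rule smooth_on_chartI[where G = G])
    show "Ck_on k G W" for k
      unfolding G_def xpart_def ypart_def
      by (intro Ck_on_Pair Ck_on_smult Ck_on_inverse Ck_on_vec_lambda Ck_on_nth Ck_on_ident W)
        (auto simp: W_def)
    fix p assume p: "p \<in> {p \<in> pts total_mfd \<inter> U. sep_proj p \<in> V}"
    then obtain x y where xy: "p = hopf (vjoin x y)" "x \<noteq> 0" "y \<noteq> 0" "vjoin x y \<noteq> 0"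
      by (auto elim: total_cases)
    then have nz: "vjoin x y $ k \<noteq> 0" "x $ i \<noteq> 0" "y $ j \<noteq> 0"
      using p by (auto simp: U V sep_proj_hopf hopf_mem_chart_iff)
    then show "\<phi> p \<in> W \<and> G (\<phi> p) = \<psi> (sep_proj p)"
      using xy by (simp add: U V W_def G_def sep_proj_hopf affine_coord_hopf vector_smult_assoc)
  qed (use W affine_coord_inj in \<open>auto simp: U\<close>)
qed

text \<open>The part of the base where \<open>x\<^sub>i \<noteq> 0\<close> and \<open>y\<^sub>j \<noteq> 0\<close>. These sets cover the base.\<close>

definition coord_box :: "'n \<Rightarrow> 'm \<Rightarrow> ('n cproj \<times> 'm cproj) set" where
  "coord_box i j = pts base_mfd \<inter> (hopf ` {x. x $ i \<noteq> 0} \<times> hopf ` {y. y $ j \<noteq> 0})"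

lemma coord_box_cases:
  assumes "q \<in> coord_box i j"
  obtains x y where "q = (hopf x, hopf y)" "poly_eval f x \<noteq> 0" "poly_eval g y \<noteq> 0"
    "x $ i \<noteq> 0" "y $ j \<noteq> 0"
proof -
  obtain x y where "q = (hopf x, hopf y)" "poly_eval f x \<noteq> 0" "poly_eval g y \<noteq> 0"
    "x \<noteq> 0" "y \<noteq> 0"
    using assms base_cases[of q] unfolding coord_box_def by blast
  then show thesis
    using that[of x y] assms by (simp add: coord_box_def hopf_mem_chart_iff)
qed

lemma over_box_cases:
  assumes "p \<in> pts total_mfd \<inter> sep_proj -` coord_box i j"
  obtains x y where "p = hopf (vjoin x y)" "poly_eval f x \<noteq> 0" "poly_eval g y \<noteq> 0"
    "x $ i \<noteq> 0" "y $ j \<noteq> 0"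
proof -
  obtain x y where "p = hopf (vjoin x y)" "poly_eval f x \<noteq> 0" "poly_eval g y \<noteq> 0"
    "x \<noteq> 0" "y \<noteq> 0"
    using assms total_cases[of p] by blast
  then show thesis
    using that[of x y] assms by (simp add: coord_box_def hopf_mem_chart_iff sep_proj_hopf)
qed

lemma hopf_in_box:
  assumes "poly_eval f x \<noteq> 0" "poly_eval g y \<noteq> 0" "x $ i \<noteq> 0" "y $ j \<noteq> 0"
  shows "(hopf x, hopf y) \<in> coord_box i j"
    and "hopf (vjoin x y) \<in> pts total_mfd \<inter> sep_proj -` coord_box i j"
  using assms f_nonzero[OF assms(1)] g_nonzero[OF assms(2)]
  by (simp_all add: coord_box_def pts_base_iff hopf_mem_chart_iff sep_proj_hopf pts_total_iff vjoin_eq_0_iff)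

lemma hopf_triv_inv_in:
  assumes "poly_eval f x \<noteq> 0" "poly_eval g y \<noteq> 0" "x $ i \<noteq> 0" "y $ j \<noteq> 0" "t \<noteq> 0"
  shows "hopf (vjoin (y $ j *s x) ((t * x $ i) *s y)) \<in> pts total_mfd \<inter> sep_proj -` coord_box i j"
  by (rule hopf_in_box) (use assms in \<open>auto simp: eval_f eval_g\<close>)

lemma triv_inv_triv: "p \<in> pts total_mfd \<inter> sep_proj -` coord_box i j \<Longrightarrow> triv_inv i j (triv i j p) = p"
  by (erule over_box_cases)
    (auto simp: triv_hopf triv_inv_hopf vjoin_scale intro!: hopf_scale dest: f_nonzero
      simp: vjoin_eq_0_iff)

lemma triv_triv_inv: "q \<in> coord_box i j \<times> - {0} \<Longrightarrow> triv i j (triv_inv i j q) = q"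
proof -
  assume "q \<in> coord_box i j \<times> - {0}"
  then obtain x y t where q: "q = ((hopf x, hopf y), t)" "t \<noteq> 0" "x $ i \<noteq> 0" "y $ j \<noteq> 0"
    by (auto elim!: coord_box_cases)
  then have "x \<noteq> 0" "y \<noteq> 0"
    by auto
  then show ?thesis
    using q by (simp add: triv_hopf triv_inv_hopf hopf_scale)
qed

lemma triv_maps: "triv i j \<in> pts total_mfd \<inter> sep_proj -` coord_box i j \<rightarrow> coord_box i j \<times> - {0}"
  by (auto elim!: over_box_cases simp: triv_hopf hopf_in_box)

lemma triv_inv_maps: "triv_inv i j \<in> coord_box i j \<times> - {0} \<rightarrow> pts total_mfd \<inter> sep_proj -` coord_box i j"
proof
  fix q assume "q \<in> coord_box i j \<times> (- {0 :: complex})"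
  then obtain x y t where "q = ((hopf x, hopf y), t)" "t \<noteq> 0" "poly_eval f x \<noteq> 0"
    "poly_eval g y \<noteq> 0" "x $ i \<noteq> 0" "y $ j \<noteq> 0"
    by (auto elim!: coord_box_cases)
  then show "triv_inv i j q \<in> pts total_mfd \<inter> sep_proj -` coord_box i j"
    using hopf_triv_inv_in by (simp add: triv_inv_hopf)
qed

lemma continuous_on_triv: "continuous_on (pts total_mfd \<inter> sep_proj -` coord_box i j) (triv i j)"
proof (rule continuous_on_cprojI)
  let ?S = "{z. poly_eval f (xpart z) \<noteq> 0} \<inter> {z. poly_eval g (ypart z) \<noteq> 0} \<inter>
      {z. z $ Inl i \<noteq> 0} \<inter> {z. z $ Inr j \<noteq> 0}"
  have *: "{z. z \<noteq> 0 \<and> hopf z \<in> pts total_mfd \<inter> sep_proj -` coord_box i j} = ?S"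
  proof (intro set_eqI iffI)
    fix z assume "z \<in> ?S"
    then show "z \<in> {z. z \<noteq> 0 \<and> hopf z \<in> pts total_mfd \<inter> sep_proj -` coord_box i j}"
      using hopf_in_box(2)[of "xpart z" "ypart z" i j] by (auto simp: vjoin_parts)
  next
    fix z assume z: "z \<in> {z. z \<noteq> 0 \<and> hopf z \<in> pts total_mfd \<inter> sep_proj -` coord_box i j}"
    then have nz: "poly_eval f (xpart z) \<noteq> 0" "poly_eval g (ypart z) \<noteq> 0"
      by (auto simp: pts_total_iff)
    moreover have "(hopf (xpart z), hopf (ypart z)) \<in> coord_box i j"
      using z sep_proj_hopf[OF f_nonzero g_nonzero, OF nz] by (simp add: vjoin_parts)
    ultimately show "z \<in> ?S"
      by (simp add: coord_box_def f_nonzero g_nonzero hopf_mem_chart_iff)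
  qed
  show "open {z. z \<noteq> 0 \<and> hopf z \<in> pts total_mfd \<inter> sep_proj -` coord_box i j}"
    unfolding * by (intro open_Int open_Collect_neq continuous_intros)
  have "continuous_on ?S (\<lambda>z. ((hopf (xpart z), hopf (ypart z)), z $ Inr j / z $ Inl i))"
    by (intro continuous_on_Pair continuous_on_compose2[OF continuous_on_hopf] continuous_intros)
      (auto dest: f_nonzero g_nonzero)
  then show "continuous_on {z. z \<noteq> 0 \<and> hopf z \<in> pts total_mfd \<inter> sep_proj -` coord_box i j} (\<lambda>z. triv i j (hopf z))"
    unfolding *
  proof (rule continuous_on_eq)
    fix z assume "z \<in> ?S"
    then show "((hopf (xpart z), hopf (ypart z)), z $ Inr j / z $ Inl i) = triv i j (hopf z)"
      using triv_hopf[of "xpart z" i "ypart z" j] by (simp add: vjoin_parts)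
  qed
qed

lemma continuous_on_triv_inv: "continuous_on (coord_box i j \<times> - {0}) (triv_inv i j)"
  unfolding triv_inv_def case_prod_beta
proof (rule continuous_on_compose2[OF continuous_on_hopf])
  show "continuous_on (coord_box i j \<times> - {0})
      (\<lambda>q. vjoin (affine_coord i (fst (fst q))) (snd q *s affine_coord j (snd (fst q))))"
    by (intro continuous_on_vjoin continuous_on_smult
        continuous_on_compose2[OF continuous_on_affine_coord] continuous_intros) (auto simp: coord_box_def)
  show "(\<lambda>q. vjoin (affine_coord i (fst (fst q))) (snd q *s affine_coord j (snd (fst q))))
      ` (coord_box i j \<times> - {0}) \<subseteq> - {0}"
  proof (rule image_subsetI)
    fix q assume "q \<in> coord_box i j \<times> (- {0 :: complex})"
    then obtain a b t where q: "q = ((a, b), t)" "(a, b) \<in> coord_box i j"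
      by auto
    then obtain x where "a = hopf x" "x $ i \<noteq> 0"
      by (auto elim!: coord_box_cases)
    then have "affine_coord i a $ i = 1"
      by (subst \<open>a = hopf x\<close>, subst affine_coord_hopf) auto
    then show "vjoin (affine_coord i (fst (fst q))) (snd q *s affine_coord j (snd (fst q))) \<in> - {0}"
      using q(1) by (auto simp: vjoin_eq_0_iff)
  qed
qed

lemma charts_box_prod: "charts (prod_mfd (restrict_mfd base_mfd S) fiber_mfd) =
    {((hopf ` {x. x $ i \<noteq> 0} \<times> hopf ` {y. y $ j \<noteq> 0}) \<times> UNIV,
      map_prod (map_prod (affine_coord i) (affine_coord j)) id) | i j. True}"
  by (auto simp: prod_mfd_def restrict_mfd_def charts_base charts_fiber)

lemma inj_on_charts_box_prod:
  assumes "(U, \<phi>) \<in> charts (prod_mfd (restrict_mfd base_mfd S) fiber_mfd)"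
  shows "inj_on \<phi> U"
  using assms unfolding charts_box_prod
  by (auto intro!: map_prod_inj_on affine_coord_inj)

lemma pts_box_prod: "pts (prod_mfd (restrict_mfd base_mfd (coord_box i j)) fiber_mfd) = coord_box i j \<times> - {0}"
  by (auto simp: prod_mfd_def restrict_mfd_def pts_fiber coord_box_def)

lemma pts_over_box: "pts (restrict_mfd total_mfd (sep_proj -` coord_box i j)) = pts total_mfd \<inter> sep_proj -` coord_box i j"
  and charts_over_box: "charts (restrict_mfd total_mfd S) = charts total_mfd"
  by (simp_all add: restrict_mfd_def)

lemma smooth_triv:
  "smooth_map (restrict_mfd total_mfd (sep_proj -` coord_box i j))
    (prod_mfd (restrict_mfd base_mfd (coord_box i j)) fiber_mfd) (triv i j)"
proof (rule smooth_mapI, unfold pts_box_prod pts_over_box charts_over_box)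
  fix U \<phi> V \<psi>
  assume "(U, \<phi>) \<in> charts total_mfd" "(V, \<psi>) \<in> charts (prod_mfd (restrict_mfd base_mfd (coord_box i j)) fiber_mfd)"
  then obtain k i' j' where U: "U = hopf ` {z. z $ k \<noteq> 0}" "\<phi> = affine_coord k"
    and V: "V = (hopf ` {x. x $ i' \<noteq> 0} \<times> hopf ` {y. y $ j' \<noteq> 0}) \<times> UNIV"
      "\<psi> = map_prod (map_prod (affine_coord i') (affine_coord j')) id"
    by (auto simp: charts_total charts_box_prod)
  define W where "W = {w :: complex ^ ('n + 'm). w $ Inl i \<noteq> 0} \<inter>
    {w. w $ Inl i' \<noteq> 0} \<inter> {w. w $ Inr j' \<noteq> 0}"
  define G where "G = (\<lambda>w :: complex ^ ('n + 'm).
    ((inverse (w $ Inl i') *s xpart w, inverse (w $ Inr j') *s ypart w),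
     w $ Inr j * inverse (w $ Inl i)))"
  have W: "open W"
    unfolding W_def by (intro open_Int open_Collect_neq continuous_intros)
  show "smooth_on (\<phi> ` {p \<in> pts total_mfd \<inter> sep_proj -` coord_box i j \<inter> U. triv i j p \<in> V})
      (\<psi> \<circ> triv i j \<circ> inv_into U \<phi>)"
  proof (rule smooth_on_chartI[where G = G])
    show "Ck_on k G W" for k
      unfolding G_def xpart_def ypart_def
      by (intro Ck_on_Pair Ck_on_smult Ck_on_mult Ck_on_inverse Ck_on_vec_lambda Ck_on_nth
          Ck_on_ident W) (auto simp: W_def)
    fix p assume p: "p \<in> {p \<in> pts total_mfd \<inter> sep_proj -` coord_box i j \<inter> U. triv i j p \<in> V}"
    then obtain x y where xy: "p = hopf (vjoin x y)" "x $ i \<noteq> 0" "y $ j \<noteq> 0"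
      using over_box_cases[of p i j] by blast
    then have [simp]: "x \<noteq> 0" "y \<noteq> 0"
      by auto
    have nz: "vjoin x y $ k \<noteq> 0" "x $ i' \<noteq> 0" "y $ j' \<noteq> 0"
      using p xy by (auto simp: U V triv_hopf hopf_mem_chart_iff vjoin_eq_0_iff)
    then show "\<phi> p \<in> W \<and> G (\<phi> p) = \<psi> (triv i j p)"
      using xy by (simp add: U V W_def G_def triv_hopf affine_coord_hopf vjoin_eq_0_iff
          vector_smult_assoc field_simps)
  qed (use W affine_coord_inj in \<open>auto simp: U\<close>)
qed (rule triv_maps continuous_on_triv)+

lemma smooth_triv_inv:
  "smooth_map (prod_mfd (restrict_mfd base_mfd (coord_box i j)) fiber_mfd)
    (restrict_mfd total_mfd (sep_proj -` coord_box i j)) (triv_inv i j)"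
proof (rule smooth_mapI, unfold pts_box_prod pts_over_box charts_over_box)
  fix U \<phi> V \<psi>
  assume U_chart: "(U, \<phi>) \<in> charts (prod_mfd (restrict_mfd base_mfd (coord_box i j)) fiber_mfd)"
    and "(V, \<psi>) \<in> charts total_mfd"
  then obtain k i' j' where V: "V = hopf ` {z. z $ k \<noteq> 0}" "\<psi> = affine_coord k"
    and U: "U = (hopf ` {x. x $ i' \<noteq> 0} \<times> hopf ` {y. y $ j' \<noteq> 0}) \<times> UNIV"
      "\<phi> = map_prod (map_prod (affine_coord i') (affine_coord j')) id"
    by (auto simp: charts_total charts_box_prod)
  \<comment> \<open>The polynomial representative of the inverse trivialization. When evaluated at affine
    coordinates instead of \<open>(x, y)\<close> it changes by a nonzero factor, which the target chart cancels.\<close>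
  define v where "v = (\<lambda>w :: ((complex ^ 'n) \<times> (complex ^ 'm)) \<times> complex.
    vjoin ((snd (fst w) $ j) *s fst (fst w)) ((snd w * fst (fst w) $ i) *s snd (fst w)))"
  define W where "W = {w. v w $ k \<noteq> 0}"
  define G where "G = (\<lambda>w. inverse (v w $ k) *s v w)"
  have v: "Ck_on n v S" if "open S" for n S
  proof -
    have "Ck_on n (\<lambda>w. case l of
          Inl a \<Rightarrow> ((snd (fst w) $ j) *s fst (fst w)) $ a
        | Inr b \<Rightarrow> ((snd w * fst (fst w) $ i) *s snd (fst w)) $ b) S" for l
      by (cases l; simp only: sum.case vector_smult_component)
        (intro Ck_on_mult Ck_on_nth Ck_on_fst Ck_on_snd Ck_on_ident that)+
    then show ?thesis
      unfolding v_def vjoin_def by (intro Ck_on_vec_lambda that)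
  qed
  have "continuous_on UNIV v"
    using v[of UNIV 0] by simp
  then have W: "open W"
    unfolding W_def by (intro open_Collect_neq continuous_intros)
  show "smooth_on (\<phi> ` {p \<in> (coord_box i j \<times> - {0}) \<inter> U. triv_inv i j p \<in> V})
      (\<psi> \<circ> triv_inv i j \<circ> inv_into U \<phi>)"
  proof (rule smooth_on_chartI[where G = G])
    show "inj_on \<phi> U"
      by (rule inj_on_charts_box_prod[OF U_chart])
    show "Ck_on n G W" for n
      unfolding G_def by (intro Ck_on_smult Ck_on_inverse Ck_on_nth v W) (auto simp: W_def)
    fix p assume p: "p \<in> {p \<in> (coord_box i j \<times> - {0}) \<inter> U. triv_inv i j p \<in> V}"
    then obtain x y t where xy: "p = ((hopf x, hopf y), t)" "x $ i \<noteq> 0" "y $ j \<noteq> 0" "t \<noteq> 0"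
      by (auto elim!: coord_box_cases)
    then have [simp]: "x \<noteq> 0" "y \<noteq> 0"
      by auto
    have i'j': "x $ i' \<noteq> 0" "y $ j' \<noteq> 0"
      using p xy by (auto simp: U hopf_mem_chart_iff)
    define u where "u = vjoin (y $ j *s x) ((t * x $ i) *s y)"
    have u: "triv_inv i j p = hopf u" "u \<noteq> 0"
      using xy by (auto simp: triv_inv_hopf u_def vjoin_eq_0_iff scale_eq_0_iff)
    then have "u $ k \<noteq> 0"
      using p by (auto simp: V hopf_mem_chart_iff)
    moreover have "v (\<phi> p) = inverse (x $ i' * y $ j') *s u"
      using xy by (simp add: v_def u_def U affine_coord_hopf vjoin_scale[symmetric]
          vector_smult_assoc mult_ac)
    ultimately show "\<phi> p \<in> W \<and> G (\<phi> p) = \<psi> (triv_inv i j p)"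
      using i'j' u by (simp add: W_def G_def V affine_coord_hopf vector_smult_assoc field_simps)
  qed (use W in auto)
qed (rule triv_inv_maps continuous_on_triv_inv)+

lemma local_trivialization_triv: "local_trivialization total_mfd base_mfd fiber_mfd sep_proj (coord_box i j) (triv i j)"
  unfolding local_trivialization_def
proof (intro conjI ballI)
  have "open (hopf ` {x :: complex ^ 'n. x $ i \<noteq> 0} \<times> hopf ` {y :: complex ^ 'm. y $ j \<noteq> 0})"
    by (intro open_Times open_hopf_chart)
  then show "openin (top_of_set (pts base_mfd)) (coord_box i j)"
    unfolding coord_box_def by (simp add: openin_open_Int)
  show "diffeomorphism (restrict_mfd total_mfd (sep_proj -` coord_box i j))
      (prod_mfd (restrict_mfd base_mfd (coord_box i j)) fiber_mfd) (triv i j)"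
    by (rule diffeomorphismI[OF smooth_triv smooth_triv_inv])
      (simp_all only: pts_over_box pts_box_prod triv_inv_triv triv_triv_inv inj_on_charts_box_prod)
qed (simp add: triv_def)

lemma smooth_fibration_sep_proj: "smooth_fibration total_mfd base_mfd fiber_mfd sep_proj"
  unfolding smooth_fibration_def
proof (intro conjI ballI smooth_sep_proj)
  fix b assume "b \<in> pts base_mfd"
  then obtain x y where b: "b = (hopf x, hopf y)" "poly_eval f x \<noteq> 0" "poly_eval g y \<noteq> 0"
    "x \<noteq> 0" "y \<noteq> 0"
    by (rule base_cases)
  obtain i where "x $ i \<noteq> 0" using b by (auto elim: nonzero_coordinate)
  moreover obtain j where "y $ j \<noteq> 0" using b by (auto elim: nonzero_coordinate)
  ultimately have "b \<in> coord_box i j"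
    using b hopf_in_box by simp
  then show "\<exists>U \<phi>. b \<in> U \<and> local_trivialization total_mfd base_mfd fiber_mfd sep_proj U \<phi>"
    using local_trivialization_triv by blast
qed

section \<open>Triviality of the monodromy\<close>

text \<open>The function \<open>g\<^sup>r / f\<^sup>s\<close>. Numerator and denominator are both homogeneous of degree \<open>r s\<close>,
  so that it is well defined on projective space, and it is finite and nonzero on the total space.\<close>

definition ratio :: "('n + 'm) cproj \<Rightarrow> complex" where
  "ratio p = poly_eval g (ypart (rep_cproj p)) ^ r / poly_eval f (xpart (rep_cproj p)) ^ s"

lemma ratio_hopf:
  assumes "z \<noteq> 0"
  shows "ratio (hopf z) = poly_eval g (ypart z) ^ r / poly_eval f (xpart z) ^ s"
proof -
  obtain c where c: "c \<noteq> 0" "rep_cproj (hopf z) = c *s z"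
    using assms by (rule rep_hopf)
  have "(c ^ s) ^ r = (c ^ r) ^ s"
    by (simp add: mult.commute flip: power_mult)
  then show ?thesis
    using c(1) by (simp add: ratio_def c(2) eval_f eval_g power_mult_distrib)
qed

lemma ratio_total: "ratio \<in> pts total_mfd \<rightarrow> - {0}"
  by (auto elim!: total_cases simp: ratio_hopf)

lemma continuous_on_ratio: "continuous_on (pts total_mfd) ratio"
proof (rule continuous_on_cprojI)
  show "open {z. z \<noteq> 0 \<and> hopf z \<in> pts total_mfd}"
    unfolding total_preimage by (intro open_Int open_Collect_neq continuous_intros)
  have "continuous_on {z. z \<noteq> 0 \<and> hopf z \<in> pts total_mfd}
      (\<lambda>z. poly_eval g (ypart z) ^ r / poly_eval f (xpart z) ^ s)"
    unfolding total_preimage by (intro continuous_intros) auto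
  then show "continuous_on {z. z \<noteq> 0 \<and> hopf z \<in> pts total_mfd} (\<lambda>z. ratio (hopf z))"
    by (rule continuous_on_eq) (simp add: ratio_hopf)
qed

text \<open>In the coordinate \<open>t\<close> of a fiber, \<open>ratio\<close> is a nonzero constant times \<open>t\<^sup>r\<^sup>s\<close>. Transport
  around a loop preserves \<open>ratio\<close> up to homotopy, hence has degree one on the fiber.\<close>

lemma trivial_monodromy_sep_proj: "trivial_geometric_monodromy total_mfd base_mfd fiber_mfd sep_proj"
  unfolding trivial_geometric_monodromy_def
proof (intro allI impI, elim conjE)
  fix \<gamma> h
  assume \<gamma>: "path \<gamma>" "path_image \<gamma> \<subseteq> pts base_mfd" "pathfinish \<gamma> = pathstart \<gamma>"
    and tr: "transport total_mfd base_mfd fiber_mfd sep_proj \<gamma> 0 1 h"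
  define b where "b = pathstart \<gamma>"
  define X where "X = pts total_mfd \<inter> sep_proj -` {b}"
  have b01: "\<gamma> 0 = b" "\<gamma> 1 = b"
    using \<gamma>(3) by (simp_all add: b_def pathstart_def pathfinish_def)
  have h: "continuous_on X h" "h \<in> X \<rightarrow> X"
    "homotopic_with_canon (\<lambda>_. True) X (- {0}) ratio (ratio \<circ> h)"
    using transport_homotopic[OF tr _ _ _ continuous_on_ratio ratio_total] \<gamma>(1)
    by (auto simp: path_def b01 X_def)
  have "b \<in> pts base_mfd"
    using \<gamma>(2) by (auto simp: b_def)
  then obtain x y where xy: "b = (hopf x, hopf y)" "poly_eval f x \<noteq> 0" "poly_eval g y \<noteq> 0"
    "x \<noteq> 0" "y \<noteq> 0"
    by (rule base_cases)
  obtain i where i: "x $ i \<noteq> 0" using xy by (auto elim: nonzero_coordinate)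
  obtain j where j: "y $ j \<noteq> 0" using xy by (auto elim: nonzero_coordinate)
  have b_box: "b \<in> coord_box i j"
    using xy i j by (simp add: hopf_in_box)
  \<comment> \<open>Mutually inverse homeomorphisms between \<open>\<complex>\<^sup>*\<close> and the fiber \<open>X\<close> over the base point.\<close>
  define \<iota> where "\<iota> = (\<lambda>t. triv_inv i j (b, t))"
  define \<tau> where "\<tau> = (\<lambda>p. snd (triv i j p))"
  have X_sub: "X \<subseteq> pts total_mfd \<inter> sep_proj -` coord_box i j"
    using b_box by (auto simp: X_def)
  have triv_X: "triv i j p = (b, \<tau> p)" if "p \<in> X" for p
    using that by (simp add: \<tau>_def triv_def X_def)
  have \<iota>_\<tau>: "\<iota> (\<tau> p) = p" if "p \<in> X" for p
    using triv_inv_triv[of p i j] triv_X[OF that] X_sub that by (auto simp: \<iota>_def)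
  have \<tau>: "continuous_on X \<tau>" "\<tau> \<in> X \<rightarrow> - {0}"
  proof -
    show "continuous_on X \<tau>"
      unfolding \<tau>_def by (intro continuous_on_snd continuous_on_subset[OF continuous_on_triv X_sub])
    show "\<tau> \<in> X \<rightarrow> - {0}"
    proof
      fix p assume "p \<in> X"
      then have "triv i j p \<in> coord_box i j \<times> - {0}"
        using X_sub triv_maps by blast
      then show "\<tau> p \<in> - {0}"
        by (simp add: \<tau>_def mem_Times_iff)
    qed
  qed
  have \<iota>: "continuous_on (- {0}) \<iota>" "\<iota> \<in> - {0} \<rightarrow> X"
  proof -
    show "continuous_on (- {0}) \<iota>"
      unfolding \<iota>_def
      by (rule continuous_on_compose2[OF continuous_on_triv_inv[of i j]])
        (use b_box in \<open>auto intro!: continuous_intros\<close>)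
    show "\<iota> \<in> - {0} \<rightarrow> X"
    proof
      fix t :: complex assume "t \<in> - {0}"
      then have t: "(b, t) \<in> coord_box i j \<times> - {0}"
        using b_box by simp
      then have "sep_proj (\<iota> t) = b"
        using triv_triv_inv[OF t] by (simp add: \<iota>_def triv_def)
      then show "\<iota> t \<in> X"
        using triv_inv_maps[of i j] t by (auto simp: X_def \<iota>_def)
    qed
  qed
  define c where "c = (x $ i ^ s * poly_eval g y) ^ r / (y $ j ^ r * poly_eval f x) ^ s"
  have "c \<noteq> 0"
    using xy i j by (simp add: c_def)
  have ratio_\<iota>: "ratio (\<iota> t) = c * t ^ (r * s)" if "t \<noteq> 0" for t
  proof -
    have "vjoin (y $ j *s x) ((t * x $ i) *s y) \<noteq> 0"
      using xy j by (simp add: vjoin_eq_0_iff scale_eq_0_iff)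
    then show ?thesis
      using i j xy
      by (simp add: \<iota>_def triv_inv_hopf ratio_hopf c_def eval_f eval_g power_mult_distrib
          mult_ac flip: power_mult)
  qed
  \<comment> \<open>The monodromy, read in the coordinate of the fiber.\<close>
  define k where "k = \<tau> \<circ> h \<circ> \<iota>"
  have k_eq: "\<iota> (k t) = h (\<iota> t)" "k t \<noteq> 0" if "t \<noteq> 0" for t
  proof -
    have "h (\<iota> t) \<in> X"
      using that \<iota>(2) h(2) by auto
    then show "\<iota> (k t) = h (\<iota> t)" "k t \<noteq> 0"
      using \<iota>_\<tau> \<tau>(2) by (auto simp: k_def)
  qed
  have "homotopic_with_canon (\<lambda>_. True) (- {0}) (- {0}) k id"
  proof (rule homotopic_id_if_power_homotopic)
    show "continuous_on (- {0}) k"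
      unfolding k_def
      by (intro continuous_on_compose \<iota>(1) continuous_on_subset[OF h(1)] continuous_on_subset[OF \<tau>(1)])
        (use \<iota>(2) h(2) in auto)
    show "k \<in> - {0} \<rightarrow> - {0}"
      using k_eq by auto
    show "r * s > 0" "c \<noteq> 0"
      using r s \<open>c \<noteq> 0\<close> by auto
    have "homotopic_with_canon (\<lambda>_. True) (- {0}) (- {0}) (ratio \<circ> \<iota>) ((ratio \<circ> h) \<circ> \<iota>)"
      by (rule homotopic_with_compose_continuous_map_right[OF h(3)]) (use \<iota> in auto)
    then show "homotopic_with_canon (\<lambda>_. True) (- {0}) (- {0})
        (\<lambda>t. c * t ^ (r * s)) (\<lambda>t. c * k t ^ (r * s))"
    proof (rule homotopic_with_eq)
      show "c * t ^ (r * s) = (ratio \<circ> \<iota>) t" if "t \<in> topspace (top_of_set (- {0}))" for t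
        using that ratio_\<iota> by simp
      show "c * k t ^ (r * s) = (ratio \<circ> h \<circ> \<iota>) t" if "t \<in> topspace (top_of_set (- {0}))" for t
        using that ratio_\<iota>[of "k t"] k_eq[of t] by simp
    qed simp
  qed
  then have "homotopic_with_canon (\<lambda>_. True) (- {0}) X (\<iota> \<circ> k) (\<iota> \<circ> id)"
    by (rule homotopic_with_compose_continuous_map_left) (use \<iota> in auto)
  then have "homotopic_with_canon (\<lambda>_. True) X X ((\<iota> \<circ> k) \<circ> \<tau>) ((\<iota> \<circ> id) \<circ> \<tau>)"
    by (rule homotopic_with_compose_continuous_map_right) (use \<tau> in auto)
  then have "homotopic_with_canon (\<lambda>_. True) X X h id"
  proof (rule homotopic_with_eq)
    show "h p = (\<iota> \<circ> k \<circ> \<tau>) p" if "p \<in> topspace (top_of_set X)" for p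
      using that k_eq(1)[of "\<tau> p"] \<tau>(2) \<iota>_\<tau>[of p] by (auto simp: Pi_iff)
    show "id p = (\<iota> \<circ> id \<circ> \<tau>) p" if "p \<in> topspace (top_of_set X)" for p
      using that \<iota>_\<tau>[of p] by simp
  qed simp
  then show "homotopic_with_canon (\<lambda>_. True) (pts total_mfd \<inter> sep_proj -` {pathstart \<gamma>})
      (pts total_mfd \<inter> sep_proj -` {pathstart \<gamma>}) h id"
    by (simp add: X_def b_def)
qed

end

theorem lemma1p2:
  fixes f :: "'n::finite cpoly" and g :: "'m::finite cpoly" and r s :: nat
  assumes "r > 0" and "s > 0"
    and "homogeneous r f" and "reduced_poly f"
    and "homogeneous s g" and "reduced_poly g"
  defines "M \<equiv> restrict_mfd proj_mfd (hopf ` milnor_fiber (sep_prod f g))"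
    and "N \<equiv> prod_mfd (restrict_mfd proj_mfd (hopf ` milnor_fiber f))
                       (restrict_mfd proj_mfd (hopf ` milnor_fiber g))"
    and "F \<equiv> restrict_mfd (euclidean_mfd :: (complex, complex) mfd) (- {0})"
  shows "\<exists>\<pi> :: ('n + 'm) cproj \<Rightarrow> 'n cproj \<times> 'm cproj.
           (\<forall>x y. vjoin x y \<noteq> 0 \<and> hopf (vjoin x y) \<in> pts M \<longrightarrow>
                  \<pi> (hopf (vjoin x y)) = (hopf x, hopf y)) \<and>
           smooth_fibration M N F \<pi> \<and>
           trivial_geometric_monodromy M N F \<pi>"
proof -
  interpret separated_polys f g r s
    using assms by unfold_locales
  have MNF: "M = total_mfd" "N = base_mfd" "F = fiber_mfd"
    by (simp_all add: M_def N_def F_def total_mfd_def base_mfd_def fiber_mfd_def)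
  have "sep_proj (hopf (vjoin x y)) = (hopf x, hopf y)"
    if "vjoin x y \<noteq> 0" "hopf (vjoin x y) \<in> pts total_mfd" for x y
    using that pts_total_iff f_nonzero g_nonzero by (intro sep_proj_hopf) auto
  then show ?thesis
    unfolding MNF using smooth_fibration_sep_proj trivial_monodromy_sep_proj by blast
qed

end
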